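(* Let $\lambda\in C=L^*\cap\{H=1\}$, and let $h_4\ge h_5\ge0$. (i) If $E\ne h_4>h_5$ or $h_4=h_5$, then for any $t>0$ there exists a unique solution $\lambda_t$ to system $(\ast)$ of the context with $\lambda_0=\lambda$, and respectively a unique bang-bang trajectory $q(t)=\pi(\lambda_t)=:\mathrm{Exp}(\lambda,t)$. (ii) If $E=h_4>h_5$, then for any $T>0$ there exist a finite number of solutions $\{\lambda^1_t,\dots,\lambda^N_t\}$, $t\in[0,T]$, to system $(\ast)$ with $\lambda^1_0=\dots=\lambda^N_0=\lambda$, and respectively a finite number of bang-bang trajectories $\{q^1(t),\dots,q^N(t)\}=\{\pi(\lambda^1_t),\dots,\pi(\lambda^N_t)\}=:\mathrm{Exp}(\lambda,t)$.
   Context: Let $M=\mathbb R^5$ with coordinates $(x,y,z,v,w)$ be the Cartan group with identity $\mathrm{Id}=0$ and left-invariant vector fields $X_1=\partial_x-\frac y2\partial_z-\frac{x^2+y^2}{2}\partial_w$, $X_2=\partial_y+\frac x2\partial_z+\frac{x^2+y^2}{2}\partial_v$, $X_3=\partial_z+x\partial_v+y\partial_w$, $X_4=\partial_v$, $X_5=\partial_w$. The underlying problem is the time-optimal problem for $\dot q=u_1X_1+u_2X_2$, $\max(|u_1|,|u_2|)\le1$, $q(0)=\mathrm{Id}$. For $\lambda\in T^*M$ put $h_i(\lambda)=\langle\lambda,X_i\rangle$, $i=1,\dots,5$; $\pi:T^*M\to M$ is the projection; $L^*=T^*_{\mathrm{Id}}M$ has coordinates $(h_1,\dots,h_5)$.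 Put $H=|h_1|+|h_2|$ and $E=\frac{h_3^2}{2}+h_1h_5-h_2h_4$. A normal extremal arc of the Pontryagin maximum principle is called bang-bang if $h_1h_2(\lambda_t)=0$ at only finitely many times $t$. Bang-bang extremals satisfy, where $h_1h_2(\lambda_t)\ne0$, the Hamiltonian system with Hamiltonian $H$: $\dot h_1=-s_2h_3$, $\dot h_2=s_1h_3$, $\dot h_3=s_1h_4+s_2h_5$, $\dot h_4=\dot h_5=0$, $\dot q=s_1X_1+s_2X_2$, with $s_i=\operatorname{sgn}h_i$; the corresponding trajectories $q(t)$ are the bang-bang trajectories. By homogeneity one takes $H\equiv1$. The square $\{|h_1|+|h_2|=1\}$ is parameterized by $\theta\in\mathbb R/2\pi\mathbb Z$: $h_1=\operatorname{sgn}(\cos\theta)\cos^2\theta$, $h_2=\operatorname{sgn}(\sin\theta)\sin^2\theta$. The vertical part of the Hamiltonian system then becomes system $(\ast)$: $$\dot\theta=\frac{h_3}{|\sin2\theta|},\quad\theta\ne\frac{\pi n}2,\qquad \dot h_3=s_1h_4+s_2h_5,\qquad s_1=\operatorname{sgn}\cos\theta,\ s_2=\operatorname{sgn}\sin\theta,$$ with $h_4,h_5$ constant. Along bang-bang arcs $\theta(t)$ is continuous, and smooth for $\theta\ne\frac{\pi n}{2}$.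
   Formalization: Part (i) additionally assumes that E = -h4 and h1h2 = 0 do not both hold: from such a λ (e.g. θ = π/2, h3 = 0) conservation of E and H forces h1h2 = 0 for all t, so no bang-bang trajectory starts there and existence fails. *)

theory Defs
  imports "HOL-Analysis.Analysis"
begin

type_synonym real5 = "real \<times> real \<times> real \<times> real \<times> real"

text \<open>The left-invariant frame of the Cartan group, in the coordinates \<open>(x, y, z, v, w)\<close>.\<close>

fun X1 :: "real5 \<Rightarrow> real5" where
  "X1 (x, y, z, v, w) = (1, 0, - y / 2, 0, - (x\<^sup>2 + y\<^sup>2) / 2)"

fun X2 :: "real5 \<Rightarrow> real5" where
  "X2 (x, y, z, v, w) = (0, 1, x / 2, (x\<^sup>2 + y\<^sup>2) / 2, 0)"

fun X3 :: "real5 \<Rightarrow> real5" where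
  "X3 (x, y, z, v, w) = (0, 0, 1, x, y)"

fun X4 :: "real5 \<Rightarrow> real5" where
  "X4 (x, y, z, v, w) = (0, 0, 0, 1, 0)"

fun X5 :: "real5 \<Rightarrow> real5" where
  "X5 (x, y, z, v, w) = (0, 0, 0, 0, 1)"

text \<open>A point of the cotangent bundle is a pair \<open>(q, p)\<close> of a base point and the components
  of a covector in the basis \<open>dx, dy, dz, dv, dw\<close>; the projection to the base is \<^const>\<open>fst\<close>
  and the pairing of covectors with vectors is the standard inner product.\<close>

type_synonym cotangent = "real5 \<times> real5"

definition h1 :: "cotangent \<Rightarrow> real" where "h1 l = snd l \<bullet> X1 (fst l)"
definition h2 :: "cotangent \<Rightarrow> real" where "h2 l = snd l \<bullet> X2 (fst l)"
definition h3 :: "cotangent \<Rightarrow> real" where "h3 l = snd l \<bullet> X3 (fst l)"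
definition h4 :: "cotangent \<Rightarrow> real" where "h4 l = snd l \<bullet> X4 (fst l)"
definition h5 :: "cotangent \<Rightarrow> real" where "h5 l = snd l \<bullet> X5 (fst l)"

definition h_coords :: "cotangent \<Rightarrow> real5" where
  "h_coords l = (h1 l, h2 l, h3 l, h4 l, h5 l)"

definition hamiltonian :: "cotangent \<Rightarrow> real" where
  "hamiltonian l = \<bar>h1 l\<bar> + \<bar>h2 l\<bar>"

definition energy :: "cotangent \<Rightarrow> real" where
  "energy l = (h3 l)\<^sup>2 / 2 + h1 l * h5 l - h2 l * h4 l"

definition C_level :: "cotangent set" where
  "C_level = {l. fst l = 0 \<and> hamiltonian l = 1}"

text \<open>Bang-bang extremals on \<open>[0, T]\<close>. At the finitely many switching times only continuity is
  required; derivatives at the end points of the interval are one-sided.\<close>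

definition bang_bang_extremal :: "real \<Rightarrow> (real \<Rightarrow> cotangent) \<Rightarrow> bool" where
  "bang_bang_extremal T \<gamma> \<longleftrightarrow>
     continuous_on {0..T} \<gamma> \<and>
     finite {t \<in> {0..T}. h1 (\<gamma> t) * h2 (\<gamma> t) = 0} \<and>
     (\<forall>t\<in>{0..T}. h1 (\<gamma> t) * h2 (\<gamma> t) \<noteq> 0 \<longrightarrow>
        (let s1 = sgn (h1 (\<gamma> t)); s2 = sgn (h2 (\<gamma> t)) in
          ((\<lambda>s. h1 (\<gamma> s)) has_real_derivative - s2 * h3 (\<gamma> t)) (at t within {0..T}) \<and>
          ((\<lambda>s. h2 (\<gamma> s)) has_real_derivative s1 * h3 (\<gamma> t)) (at t within {0..T}) \<and>
          ((\<lambda>s. h3 (\<gamma> s)) has_real_derivative s1 * h4 (\<gamma> t) + s2 * h5 (\<gamma> t))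
             (at t within {0..T}) \<and>
          ((\<lambda>s. h4 (\<gamma> s)) has_real_derivative 0) (at t within {0..T}) \<and>
          ((\<lambda>s. h5 (\<gamma> s)) has_real_derivative 0) (at t within {0..T}) \<and>
          ((\<lambda>s. fst (\<gamma> s)) has_vector_derivative
             s1 *\<^sub>R X1 (fst (\<gamma> t)) + s2 *\<^sub>R X2 (fst (\<gamma> t))) (at t within {0..T})))"

text \<open>The sets of curves below consist of functions that are \<^const>\<open>undefined\<close> outside
  \<open>[0, T]\<close>, so that their elements correspond to genuine curves on \<open>[0, T]\<close> and can be
  counted.\<close>

definition bang_bang_extremals :: "cotangent \<Rightarrow> real \<Rightarrow> (real \<Rightarrow> cotangent) set" where
  "bang_bang_extremals l T =
     {\<gamma> \<in> extensional {0..T}. \<gamma> 0 = l \<and> bang_bang_extremal T \<gamma>}"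

definition bang_bang_trajectories :: "cotangent \<Rightarrow> real \<Rightarrow> (real \<Rightarrow> real5) set" where
  "bang_bang_trajectories l T =
     (\<lambda>\<gamma>. restrict (fst \<circ> \<gamma>) {0..T}) ` bang_bang_extremals l T"

text \<open>The system in \<open>(\<theta>, h\<^sub>3)\<close>, again along bang-bang arcs: \<open>\<theta>\<close> is continuous and is an
  integer multiple of \<open>\<pi>/2\<close> only finitely often. The angle is a continuous real-valued lift of
  the circle-valued one.\<close>

definition switching_angle :: "real \<Rightarrow> bool" where
  "switching_angle \<theta> \<longleftrightarrow> (\<exists>n::int. \<theta> = pi * of_int n / 2)"

definition theta_system :: "real \<Rightarrow> real \<Rightarrow> real \<Rightarrow> (real \<Rightarrow> real) \<Rightarrow> (real \<Rightarrow> real) \<Rightarrow> bool" where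
  "theta_system a4 a5 T \<theta> \<eta> \<longleftrightarrow>
     continuous_on {0..T} \<theta> \<and> continuous_on {0..T} \<eta> \<and>
     finite {t \<in> {0..T}. switching_angle (\<theta> t)} \<and>
     (\<forall>t\<in>{0..T}. \<not> switching_angle (\<theta> t) \<longrightarrow>
        (\<theta> has_real_derivative \<eta> t / \<bar>sin (2 * \<theta> t)\<bar>) (at t within {0..T}) \<and>
        (\<eta> has_real_derivative sgn (cos (\<theta> t)) * a4 + sgn (sin (\<theta> t)) * a5)
           (at t within {0..T}))"

text \<open>Solutions as curves in the fibre over the identity with coordinates \<open>(h\<^sub>1, \<dots>, h\<^sub>5)\<close>;
  this removes the ambiguity of the lift of \<open>\<theta>\<close>.\<close>

definition theta_solutions :: "cotangent \<Rightarrow> real \<Rightarrow> (real \<Rightarrow> real5) set" where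
  "theta_solutions l T =
     {k \<in> extensional {0..T}. k 0 = h_coords l \<and>
        (\<exists>\<theta> \<eta>. theta_system (h4 l) (h5 l) T \<theta> \<eta> \<and>
           (\<forall>t\<in>{0..T}. k t =
              (sgn (cos (\<theta> t)) * (cos (\<theta> t))\<^sup>2, sgn (sin (\<theta> t)) * (sin (\<theta> t))\<^sup>2,
               \<eta> t, h4 l, h5 l)))}"

text \<open>The exponential map is multivalued in general, hence set-valued.\<close>

definition Exp :: "cotangent \<Rightarrow> real \<Rightarrow> real5 set" where
  "Exp l t = (\<lambda>q. q t) ` bang_bang_trajectories l t"

text \<open>Minimum of the energy on the level \<open>H = 1\<close>. A covector in which this minimum is attained
  and \<open>h\<^sub>1 h\<^sub>2 = 0\<close> is the start of no bang-bang arc: conservation of energy forces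
  \<open>h\<^sub>3 = 0\<close>, hence \<open>h\<^sub>1\<close> and \<open>h\<^sub>2\<close> stay constant and \<open>h\<^sub>1 h\<^sub>2\<close> vanishes identically. Existence of
  solutions can therefore only be claimed away from these covectors.\<close>

lemma energy_lower_bound:
  fixes a b c p r :: real
  assumes "\<bar>a\<bar> + \<bar>b\<bar> = 1" "p \<ge> r" "r \<ge> 0"
  shows "c\<^sup>2 / 2 - p \<le> c\<^sup>2 / 2 + a * r - b * p"
proof -
  have "- a * r \<le> \<bar>a\<bar> * p"
    using assms by (smt (verit) mult_mono mult_right_mono)
  moreover have "b * p \<le> \<bar>b\<bar> * p"
    using assms by (simp add: mult_right_mono)
  moreover have "\<bar>a\<bar> * p + \<bar>b\<bar> * p = p"
    using assms(1) by (simp flip: distrib_right)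
  ultimately show ?thesis by linarith
qed

lemma const_if_zero_derivative:
  fixes f :: "real \<Rightarrow> real"
  assumes "continuous_on {0..T} f" "finite K"
    and "\<And>t. t \<in> {0..T} - K \<Longrightarrow> (f has_real_derivative 0) (at t within {0..T})"
    and "t \<in> {0..T}"
  shows "f t = f 0"
proof (rule has_derivative_zero_unique_strong_interval[OF assms(2,1)])
  show "f 0 = f 0" ..
  show "(f has_derivative (\<lambda>h. 0)) (at x within {0..T})" if "x \<in> {0..T} - K" for x
    using assms(3)[OF that] by (simp add: has_field_derivative_def lambda_zero)
qed (use assms(4) in auto)

lemma has_real_derivative_abs:
  fixes u :: real
  assumes "u \<noteq> 0"
  shows "(abs has_real_derivative sgn u) (at u)"
proof -
  have "((\<lambda>v. sgn u * v) has_real_derivative sgn u) (at u)"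
    by (auto intro!: derivative_eq_intros)
  moreover have "\<forall>\<^sub>F v in nhds u. sgn u * v = \<bar>v\<bar>"
  proof -
    have "\<forall>\<^sub>F v in nhds u. sgn v = sgn u"
    proof (cases "u > 0")
      case True
      then show ?thesis
        using eventually_nhds_in_open[of "{0<..}" u] by (auto elim: eventually_mono)
    next
      case False
      then show ?thesis
        using eventually_nhds_in_open[of "{..<0}" u] assms by (auto elim: eventually_mono)
    qed
    then show ?thesis by (rule eventually_mono) (metis mult.commute mult_sgn_abs abs_sgn)
  qed
  ultimately show ?thesis
    using DERIV_cong_ev by blast
qed

lemma no_bang_bang_arc_at_minimal_energy:
  fixes a b c :: "real \<Rightarrow> real"
  assumes "p \<ge> r" "r \<ge> 0" "T > 0"
    and cont: "continuous_on {0..T} a" "continuous_on {0..T} b" "continuous_on {0..T} c"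
    and fin: "finite {t \<in> {0..T}. a t * b t = 0}"
    and da: "\<And>t. t \<in> {0..T} \<Longrightarrow> a t * b t \<noteq> 0 \<Longrightarrow>
      (a has_real_derivative - sgn (b t) * c t) (at t within {0..T})"
    and db: "\<And>t. t \<in> {0..T} \<Longrightarrow> a t * b t \<noteq> 0 \<Longrightarrow>
      (b has_real_derivative sgn (a t) * c t) (at t within {0..T})"
    and dc: "\<And>t. t \<in> {0..T} \<Longrightarrow> a t * b t \<noteq> 0 \<Longrightarrow>
      (c has_real_derivative sgn (a t) * p + sgn (b t) * r) (at t within {0..T})"
    and init: "\<bar>a 0\<bar> + \<bar>b 0\<bar> = 1" "(c 0)\<^sup>2 / 2 + a 0 * r - b 0 * p = - p" "a 0 * b 0 = 0"
  shows False
proof -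
  define K where "K = {t \<in> {0..T}. a t * b t = 0}"
  have H: "\<bar>a t\<bar> + \<bar>b t\<bar> = 1" if "t \<in> {0..T}" for t
  proof -
    have "\<bar>a t\<bar> + \<bar>b t\<bar> = \<bar>a 0\<bar> + \<bar>b 0\<bar>"
    proof (rule const_if_zero_derivative[where K = K and T = T])
      fix s assume s: "s \<in> {0..T} - K"
      then have nz: "a s \<noteq> 0" "b s \<noteq> 0" by (auto simp: K_def)
      have "((\<lambda>s. \<bar>a s\<bar>) has_real_derivative sgn (a s) * (- sgn (b s) * c s)) (at s within {0..T})"
        using DERIV_chain2[OF has_real_derivative_abs[OF nz(1)] da] s nz by (auto simp: K_def)
      moreover have "((\<lambda>s. \<bar>b s\<bar>) has_real_derivative sgn (b s) * (sgn (a s) * c s)) (at s within {0..T})"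
        using DERIV_chain2[OF has_real_derivative_abs[OF nz(2)] db] s nz by (auto simp: K_def)
      ultimately show "((\<lambda>s. \<bar>a s\<bar> + \<bar>b s\<bar>) has_real_derivative 0) (at s within {0..T})"
        by (rule DERIV_add[THEN DERIV_cong]) (simp add: algebra_simps)
    qed (use that fin cont in \<open>auto simp: K_def intro!: continuous_intros\<close>)
    with init(1) show ?thesis by simp
  qed
  have E: "(c t)\<^sup>2 / 2 + a t * r - b t * p = - p" if "t \<in> {0..T}" for t
  proof -
    have "(c t)\<^sup>2 / 2 + a t * r - b t * p = (c 0)\<^sup>2 / 2 + a 0 * r - b 0 * p"
    proof (rule const_if_zero_derivative[where K = K and T = T])
      fix s assume s: "s \<in> {0..T} - K"
      then have "s \<in> {0..T}" "a s * b s \<noteq> 0" by (auto simp: K_def)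
      note * = da[OF this] db[OF this] dc[OF this]
      show "((\<lambda>t. (c t)\<^sup>2 / 2 + a t * r - b t * p) has_real_derivative 0) (at s within {0..T})"
        by (rule DERIV_cong[OF DERIV_diff[OF DERIV_add[OF DERIV_cdivide[OF DERIV_power[OF *(3)]]
              DERIV_cmult_right[OF *(1)]] DERIV_cmult_right[OF *(2)]]]) (simp add: algebra_simps)
    qed (use that fin cont in \<open>auto simp: K_def intro!: continuous_intros\<close>)
    with init(2) show ?thesis by simp
  qed
  have c0: "c t = 0" if "t \<in> {0..T}" for t
    using energy_lower_bound[OF H[OF that] assms(1,2), of "c t"] E[OF that] by simp
  have ab: "a t = a 0" "b t = b 0" if "t \<in> {0..T}" for t
  proof -
    show "a t = a 0"
      by (rule const_if_zero_derivative[OF cont(1) fin _ that]) (use da c0 in fastforce)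
    show "b t = b 0"
      by (rule const_if_zero_derivative[OF cont(2) fin _ that]) (use db c0 in fastforce)
  qed
  have "a t * b t = 0" if "t \<in> {0..T}" for t
    using init(3) unfolding ab[OF that] .
  then have "{t \<in> {0..T}. a t * b t = 0} = {0..T}" by blast
  with fin infinite_Icc[OF \<open>T > 0\<close>] show False by metis
qed

lemma theta_solutions_minimal_energy:
  assumes "l \<in> C_level" "h4 l \<ge> h5 l" "h5 l \<ge> 0"
    and "energy l = - h4 l" "h1 l * h2 l = 0" "T > 0"
  shows "theta_solutions l T = {}"
proof (rule ccontr)
  assume "theta_solutions l T \<noteq> {}"
  then obtain k \<theta> \<eta> where k0: "k 0 = h_coords l"
    and sys: "theta_system (h4 l) (h5 l) T \<theta> \<eta>"
    and k: "\<And>t. t \<in> {0..T} \<Longrightarrow> k t =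
        (sgn (cos (\<theta> t)) * (cos (\<theta> t))\<^sup>2, sgn (sin (\<theta> t)) * (sin (\<theta> t))\<^sup>2, \<eta> t, h4 l, h5 l)"
    unfolding theta_solutions_def by blast
  have sq: "sgn u * u\<^sup>2 = u * \<bar>u\<bar>" for u :: real
    by (simp add: sgn_real_def power2_eq_square)
  have sw: "switching_angle u \<longleftrightarrow> cos u * sin u = 0" for u
  proof -
    have "cos u * sin u = 0 \<longleftrightarrow> sin (2 * u) = 0"
      by (auto simp: sin_double)
    also have "\<dots> \<longleftrightarrow> switching_angle u"
      unfolding sin_zero_iff_int2 switching_angle_def by (auto simp: field_simps)
    finally show ?thesis ..
  qed
  have cont: "continuous_on {0..T} \<theta>" "continuous_on {0..T} \<eta>"
    using sys by (auto simp: theta_system_def)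
  let ?a = "\<lambda>t. cos (\<theta> t) * \<bar>cos (\<theta> t)\<bar>" and ?b = "\<lambda>t. sin (\<theta> t) * \<bar>sin (\<theta> t)\<bar>"
  have nz: "?a t * ?b t = 0 \<longleftrightarrow> switching_angle (\<theta> t)" for t
    by (auto simp: sw)
  have d\<theta>: "(\<theta> has_real_derivative \<eta> t / \<bar>sin (2 * \<theta> t)\<bar>) (at t within {0..T})"
    and d\<eta>: "(\<eta> has_real_derivative sgn (cos (\<theta> t)) * h4 l + sgn (sin (\<theta> t)) * h5 l)
             (at t within {0..T})" if "t \<in> {0..T}" "\<not> switching_angle (\<theta> t)" for t
    using sys that by (auto simp: theta_system_def)
  have sgnm: "sgn (u * \<bar>u\<bar>) = sgn u" for u :: real
    by (simp add: sgn_real_def mult_less_0_iff zero_less_mult_iff)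
  have init: "?a 0 = h1 l" "?b 0 = h2 l" "\<eta> 0 = h3 l"
    using k0 k[of 0] \<open>T > 0\<close> by (auto simp: h_coords_def sq)
  have dabs: "((\<lambda>u. u * \<bar>u\<bar>) has_real_derivative 2 * \<bar>u\<bar>) (at u)" if "u \<noteq> 0" for u :: real
    by (rule derivative_eq_intros has_real_derivative_abs[OF that] refl)+ (simp add: sgn_real_def abs_if that)
  have quot: "2 * \<bar>v\<bar> * (u * (e / \<bar>2 * u * v\<bar>)) = sgn u * e"
    if "u \<noteq> 0" "v \<noteq> 0" for u v e :: real
    using that by (simp add: abs_mult sgn_real_def)
  have da: "(?a has_real_derivative - sgn (?b t) * \<eta> t) (at t within {0..T})"
    and db: "(?b has_real_derivative sgn (?a t) * \<eta> t) (at t within {0..T})"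
    if "t \<in> {0..T}" "?a t * ?b t \<noteq> 0" for t
  proof -
    have ns: "\<not> switching_angle (\<theta> t)" and nz': "cos (\<theta> t) \<noteq> 0" "sin (\<theta> t) \<noteq> 0"
      using that nz[of t] by auto
    note d = d\<theta>[OF that(1) ns]
    have "((\<lambda>t. cos (\<theta> t)) has_real_derivative - sin (\<theta> t) * (\<eta> t / \<bar>sin (2 * \<theta> t)\<bar>)) (at t within {0..T})"
      by (rule derivative_eq_intros d refl)+
    from DERIV_chain2[OF dabs[OF nz'(1)] this]
    show "(?a has_real_derivative - sgn (?b t) * \<eta> t) (at t within {0..T})"
      by (rule DERIV_cong) (use quot[OF nz'(2,1), of "\<eta> t"] in \<open>simp only: sgnm sin_double mult_minus_left mult_minus_right\<close>)
    have "((\<lambda>t. sin (\<theta> t)) has_real_derivative cos (\<theta> t) * (\<eta> t / \<bar>sin (2 * \<theta> t)\<bar>)) (at t within {0..T})"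
      by (rule derivative_eq_intros d refl)+
    from DERIV_chain2[OF dabs[OF nz'(2)] this]
    show "(?b has_real_derivative sgn (?a t) * \<eta> t) (at t within {0..T})"
      by (rule DERIV_cong) (use quot[OF nz', of "\<eta> t"] in
          \<open>simp only: sgnm sin_double mult.assoc mult.commute[of "sin _" "cos _"]\<close>)
  qed
  show False
  proof (rule no_bang_bang_arc_at_minimal_energy[OF assms(2,3,6), of ?a ?b \<eta>])
    show "finite {t \<in> {0..T}. ?a t * ?b t = 0}"
      unfolding nz using sys by (simp add: theta_system_def)
    show "(\<eta> has_real_derivative sgn (?a t) * h4 l + sgn (?b t) * h5 l) (at t within {0..T})"
      if "t \<in> {0..T}" "?a t * ?b t \<noteq> 0" for t
      unfolding sgnm using d\<eta> that nz by blast
    show "\<bar>?a 0\<bar> + \<bar>?b 0\<bar> = 1"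
      using assms(1) init by (simp add: C_level_def hamiltonian_def)
    show "(\<eta> 0)\<^sup>2 / 2 + ?a 0 * h5 l - ?b 0 * h4 l = - h4 l"
      using assms(4) unfolding init energy_def .
    show "?a 0 * ?b 0 = 0"
      using assms(5) unfolding init .
  qed (use cont da db in \<open>auto intro!: continuous_intros\<close>)
qed

lemma continuous_on_h:
  assumes "continuous_on S g"
  shows "continuous_on S (\<lambda>t. h1 (g t))" "continuous_on S (\<lambda>t. h2 (g t))"
    "continuous_on S (\<lambda>t. h3 (g t))" "continuous_on S (\<lambda>t. h4 (g t))"
    "continuous_on S (\<lambda>t. h5 (g t))"
proof -
  have X: "X1 q = (1, 0, - fst (snd q) / 2, 0, - ((fst q)\<^sup>2 + (fst (snd q))\<^sup>2) / 2)"
    "X2 q = (0, 1, fst q / 2, ((fst q)\<^sup>2 + (fst (snd q))\<^sup>2) / 2, 0)"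
    "X3 q = (0, 0, 1, fst q, fst (snd q))" "X4 q = (0, 0, 0, 1, 0)" "X5 q = (0, 0, 0, 0, 1)" for q
    by (cases q; simp)+
  show "continuous_on S (\<lambda>t. h1 (g t))" "continuous_on S (\<lambda>t. h2 (g t))"
    "continuous_on S (\<lambda>t. h3 (g t))" "continuous_on S (\<lambda>t. h4 (g t))"
    "continuous_on S (\<lambda>t. h5 (g t))"
    unfolding h1_def h2_def h3_def h4_def h5_def X by (intro continuous_intros assms; simp)+
qed

lemma bang_bang_extremals_minimal_energy:
  assumes "l \<in> C_level" "h4 l \<ge> h5 l" "h5 l \<ge> 0"
    and "energy l = - h4 l" "h1 l * h2 l = 0" "T > 0"
  shows "bang_bang_extremals l T = {}"
proof (rule ccontr)
  assume "bang_bang_extremals l T \<noteq> {}"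
  then obtain g where g0: "g 0 = l" and g: "bang_bang_extremal T g"
    unfolding bang_bang_extremals_def by blast
  note cont = continuous_on_h[OF g[unfolded bang_bang_extremal_def, THEN conjunct1]]
  have fin: "finite {t \<in> {0..T}. h1 (g t) * h2 (g t) = 0}"
    using g by (simp add: bang_bang_extremal_def)
  have ode: "((\<lambda>s. h1 (g s)) has_real_derivative - sgn (h2 (g t)) * h3 (g t)) (at t within {0..T})"
    "((\<lambda>s. h2 (g s)) has_real_derivative sgn (h1 (g t)) * h3 (g t)) (at t within {0..T})"
    "((\<lambda>s. h3 (g s)) has_real_derivative sgn (h1 (g t)) * h4 (g t) + sgn (h2 (g t)) * h5 (g t))
       (at t within {0..T})"
    "((\<lambda>s. h4 (g s)) has_real_derivative 0) (at t within {0..T})"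
    "((\<lambda>s. h5 (g s)) has_real_derivative 0) (at t within {0..T})"
    if "t \<in> {0..T}" "h1 (g t) * h2 (g t) \<noteq> 0" for t
    using g that unfolding bang_bang_extremal_def Let_def by blast+
  have "h4 (g t) = h4 (g 0)" if "t \<in> {0..T}" for t
    by (rule const_if_zero_derivative[OF cont(4) fin _ that]) (use ode(4) in blast)
  moreover have "h5 (g t) = h5 (g 0)" if "t \<in> {0..T}" for t
    by (rule const_if_zero_derivative[OF cont(5) fin _ that]) (use ode(5) in blast)
  ultimately have h45: "h4 (g t) = h4 l" "h5 (g t) = h5 l" if "t \<in> {0..T}" for t
    using that g0 by auto
  show False
  proof (rule no_bang_bang_arc_at_minimal_energy[OF assms(2,3,6) cont(1-3) fin ode(1,2)])
    show "((\<lambda>s. h3 (g s)) has_real_derivative sgn (h1 (g t)) * h4 l + sgn (h2 (g t)) * h5 l)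
       (at t within {0..T})" if "t \<in> {0..T}" "h1 (g t) * h2 (g t) \<noteq> 0" for t
      using ode(3)[OF that] h45 that by simp
  qed (use assms g0 in \<open>auto simp: C_level_def hamiltonian_def energy_def\<close>)
qed

end

theory Submission
  imports Defs
begin

text \<open>
  On the level \<open>H = 1\<close> the vertical system is a one-dimensional mechanical system: unrolling the
  square \<open>\<bar>h\<^sub>1\<bar> + \<bar>h\<^sub>2\<bar> = 1\<close> onto the real line, with the vertices at the integers and a side of
  the square over each interval \<open>(n, n + 1)\<close>, it becomes \<open>s' = h\<^sub>3\<close>, \<open>h\<^sub>3' = - U'(s)\<close> with a piecewise
  linear potential \<open>U\<close> and \<open>E = h\<^sub>3\<^sup>2 / 2 + U(s)\<close>. Between switchings every motion is a parabola. At a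
  vertex the motion continues to the right iff \<open>h\<^sub>3 > 0\<close>, or \<open>h\<^sub>3 = 0\<close> and the force on the right side
  is positive, and symmetrically to the left. Both continuations are possible only at a strict
  maximum of \<open>U\<close> with \<open>h\<^sub>3 = 0\<close>, that is, for \<open>E = h\<^sub>4 > h\<^sub>5\<close>, and none only at a minimum, where
  \<open>E = - h\<^sub>4\<close>. For fixed \<open>E\<close> the time between two switchings is bounded from below, so that on
  \<open>[0, T]\<close> there are finitely many branchings. Finally \<open>\<theta>\<close> is a reparametrization of \<open>s\<close>, and \<open>q\<close> is
  recovered from the vertical part by quadrature.
\<close>

section \<open>Motions along unit edges under a piecewise constant force\<close>

text \<open>The right-hand side jumps at the vertices, and in the angular form its denominator
  vanishes there, so no uniqueness theorem for Lipschitz fields covers a switching. What replaces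
  it: inside an edge the solution is explicit, and a vertex leaves only a choice of edge. The set of
  all motions is therefore a union, over the admissible edges, of glued images of sets of motions on
  a shorter interval, and being finite and nonempty, or a singleton, passes through both operations.
  Nonzero speeds at vertices stay away from 0 because the energy is fixed and the potential takes at
  most four values there. The minimal level \<open>E = - h4\<close> stays outside this induction:
  for \<open>h4 = h5\<close> the potential is constant along a whole edge, whose inner points are
  equilibria while its vertices have no exit. Such starts are treated as motions at rest. The
  angular system and the extremals are both compared with one system for \<open>h1\<close>,
  \<open>h2\<close>, \<open>h3\<close> on \<open>H = 1\<close>.\<close>

definition edge_motion :: "(int \<Rightarrow> real) \<Rightarrow> real \<Rightarrow> (real \<Rightarrow> real \<times> real) \<Rightarrow> bool" where
  "edge_motion F T f \<longleftrightarrow> continuous_on {0..T} f \<and> finite {t \<in> {0..T}. fst (f t) \<in> \<int>} \<and>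
     (\<forall>t\<in>{0..T}. fst (f t) \<notin> \<int> \<longrightarrow>
        (f has_vector_derivative (snd (f t), F \<lfloor>fst (f t)\<rfloor>)) (at t within {0..T}))"

definition motions :: "(int \<Rightarrow> real) \<Rightarrow> real \<times> real \<Rightarrow> real \<Rightarrow> (real \<Rightarrow> real \<times> real) set" where
  "motions F x T = {f \<in> extensional {0..T}. f 0 = x \<and> edge_motion F T f}"

definition parabola :: "real \<times> real \<Rightarrow> real \<Rightarrow> real \<Rightarrow> real \<times> real" where
  "parabola x k t = (fst x + snd x * t + k * t\<^sup>2 / 2, snd x + k * t)"

definition in_edge :: "int \<Rightarrow> real \<Rightarrow> bool" where
  "in_edge n s \<longleftrightarrow> of_int n < s \<and> s < of_int n + 1"

lemma in_edge_floor: "in_edge n s \<Longrightarrow> \<lfloor>s\<rfloor> = n"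
  unfolding in_edge_def by linarith

lemma in_edge_not_Ints: "in_edge n s \<Longrightarrow> s \<notin> \<int>"
  unfolding in_edge_def by (auto elim!: Ints_cases)

lemma in_edge_if_not_Ints: "s \<notin> \<int> \<Longrightarrow> in_edge \<lfloor>s\<rfloor> s"
  unfolding in_edge_def by (metis Ints_of_int floor_correct less_eq_real_def of_int_1 of_int_add)

lemma parabola_0 [simp]: "parabola x k 0 = x"
  by (simp add: parabola_def)

lemma parabola_has_vector_derivative:
  "(parabola x k has_vector_derivative (snd (parabola x k t), k)) (at t within S)"
proof -
  have "((\<lambda>t. fst x + snd x * t + k * t\<^sup>2 / 2) has_real_derivative (snd x + k * t)) (at t within S)"
    by (auto intro!: derivative_eq_intros)
  moreover have "((\<lambda>t. snd x + k * t) has_real_derivative k) (at t within S)"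
    by (auto intro!: derivative_eq_intros)
  ultimately show ?thesis
    unfolding parabola_def snd_conv has_real_derivative_iff_has_vector_derivative
    by (rule has_vector_derivative_Pair)
qed

lemma continuous_on_parabola: "continuous_on S (parabola x k)"
  unfolding parabola_def by (intro continuous_intros; simp)

lemma edge_motion_continuous:
  assumes "edge_motion F T f"
  shows "continuous_on {0..T} f" "continuous_on {0..T} (\<lambda>t. fst (f t))" "continuous_on {0..T} (\<lambda>t. snd (f t))"
  using assms by (auto simp: edge_motion_def intro!: continuous_intros)

lemma has_vector_derivative_fst_snd:
  assumes "(f has_vector_derivative (a, b)) (at t within S)"
  shows "((\<lambda>t. fst (f t)) has_real_derivative a) (at t within S)"
    "((\<lambda>t. snd (f t)) has_real_derivative b) (at t within S)"
  using has_derivative_fst[OF assms[unfolded has_vector_derivative_def]]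
    has_derivative_snd[OF assms[unfolded has_vector_derivative_def]]
  by (simp_all add: has_real_derivative_iff_has_vector_derivative has_vector_derivative_def)

text \<open>The edge is prescribed on the open interval only, so both ends may be vertices. The
  difference to the parabola is continuous with zero derivative off the two ends, hence
  constant.\<close>

lemma edge_motion_eq_parabola:
  assumes f: "edge_motion F T f" and h: "0 \<le> h" "h \<le> T"
    and inside: "\<And>t. t \<in> {0<..<h} \<Longrightarrow> in_edge n (fst (f t))"
    and t: "t \<in> {0..h}"
  shows "f t = parabola (f 0) (F n) t"
proof -
  have sub: "{0..h} \<subseteq> {0..T}" using h by auto
  note cont = edge_motion_continuous(2,3)[OF f, THEN continuous_on_subset, OF sub]
  have d: "((\<lambda>t. fst (f t)) has_real_derivative snd (f s)) (at s within {0..h})"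
       "((\<lambda>t. snd (f t)) has_real_derivative F n) (at s within {0..h})"
    if "s \<in> {0..h} - {0, h}" for s
  proof -
    have "in_edge n (fst (f s))" using that by (intro inside) auto
    then have "(f has_vector_derivative (snd (f s), F n)) (at s within {0..T})"
      using f that sub in_edge_floor in_edge_not_Ints unfolding edge_motion_def by blast
    then have "(f has_vector_derivative (snd (f s), F n)) (at s within {0..h})"
      using has_vector_derivative_within_subset sub by blast
    from has_vector_derivative_fst_snd[OF this]
    show "((\<lambda>t. fst (f t)) has_real_derivative snd (f s)) (at s within {0..h})"
       "((\<lambda>t. snd (f t)) has_real_derivative F n) (at s within {0..h})" .
  qed
  \<comment> \<open>The speed has to be explicit before the position, whose derivative it is, can be
    compared with the parabola.\<close>
  have 1: "snd (f t) = snd (f 0) + F n * t" if t: "t \<in> {0..h}" for t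
  proof -
    have "snd (f t) - F n * t = snd (f 0) - F n * 0"
    proof (rule const_if_zero_derivative[where K = "{0,h}" and T = h])
      show "((\<lambda>t. snd (f t) - F n * t) has_real_derivative 0) (at s within {0..h})"
        if "s \<in> {0..h} - {0, h}" for s
        by (rule derivative_eq_intros d[OF that] refl)+ simp
    qed (use t cont in \<open>auto intro!: continuous_intros\<close>)
    then show ?thesis by simp
  qed
  have "fst (f t) - (snd (f 0) * t + F n * t\<^sup>2 / 2) = fst (f 0) - (snd (f 0) * 0 + F n * 0\<^sup>2 / 2)"
  proof (rule const_if_zero_derivative[where K = "{0,h}" and T = h])
    show "((\<lambda>t. fst (f t) - (snd (f 0) * t + F n * t\<^sup>2 / 2)) has_real_derivative 0) (at s within {0..h})"
      if s: "s \<in> {0..h} - {0, h}" for s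
      by (rule derivative_eq_intros d[OF s] refl)+ (use 1[of s] s in auto)
  qed (use t cont in \<open>auto intro!: continuous_intros\<close>)
  then show ?thesis using 1[OF t] by (simp add: parabola_def prod_eq_iff)
qed

text \<open>At a vertex with two exits the state does not tell which edge follows; this property of
  the germ at time 0 does, and it separates the branches.\<close>

definition enters :: "(real \<Rightarrow> real) \<Rightarrow> int \<Rightarrow> bool" where
  "enters s n \<longleftrightarrow> (\<exists>\<epsilon>>0. \<forall>t\<in>{0<..<\<epsilon>}. in_edge n (s t))"

text \<open>Intermediate values: the image is an interval that misses all integers.\<close>

lemma in_edge_const:
  fixes s :: "real \<Rightarrow> real"
  assumes "continuous_on {a<..<b} s" and "\<And>t. t \<in> {a<..<b} \<Longrightarrow> s t \<notin> \<int>" "a < b"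
  obtains n where "\<And>t. t \<in> {a<..<b} \<Longrightarrow> in_edge n (s t)"
proof -
  define n where "n = \<lfloor>s ((a+b)/2)\<rfloor>"
  have m: "(a+b)/2 \<in> {a<..<b}" using assms(3) by auto
  have "in_edge n (s t)" if t: "t \<in> {a<..<b}" for t
  proof -
    have conn: "is_interval (s ` {a<..<b})"
      unfolding is_interval_connected_1
      by (rule connected_continuous_image[OF assms(1)]) simp
    have i: "in_edge \<lfloor>s t\<rfloor> (s t)" "in_edge n (s ((a+b)/2))"
      using in_edge_if_not_Ints assms(2) t m n_def by auto
    have no: "of_int k \<notin> s ` {a<..<b}" for k
      using assms(2) by (metis Ints_of_int imageE)
    have "\<not> \<lfloor>s t\<rfloor> < n"
    proof
      assume "\<lfloor>s t\<rfloor> < n"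
      then have "s t \<le> of_int n" "of_int n \<le> s ((a+b)/2)" using i unfolding in_edge_def by linarith+
      then have "of_int n \<in> s ` {a<..<b}"
        using conn t m unfolding is_interval_1 by blast
      then show False using no by blast
    qed
    moreover have "\<not> n < \<lfloor>s t\<rfloor>"
    proof
      assume "n < \<lfloor>s t\<rfloor>"
      then have "s ((a+b)/2) \<le> of_int \<lfloor>s t\<rfloor>" "of_int \<lfloor>s t\<rfloor> \<le> s t" using i unfolding in_edge_def by linarith+
      then have "of_int \<lfloor>s t\<rfloor> \<in> s ` {a<..<b}"
        using conn t m unfolding is_interval_1 by blast
      then show False using no by blast
    qed
    ultimately show ?thesis using i by (metis linorder_neqE)
  qed
  then show ?thesis using that by blast
qed

text \<open>Here the finiteness of switching times is decisive: they cannot accumulate at 0, so some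
  initial open interval is free of them.\<close>

lemma edge_motion_enters:
  assumes f: "edge_motion F T f" and "T > 0"
  obtains n where "enters (\<lambda>t. fst (f t)) n"
proof -
  define K where "K = {t \<in> {0..T}. fst (f t) \<in> \<int>}"
  have fin: "finite K" using f by (simp add: edge_motion_def K_def)
  define \<epsilon> where "\<epsilon> = Min (insert T (K - {0}))"
  have \<epsilon>: "0 < \<epsilon>" "\<epsilon> \<le> T" "\<And>t. t \<in> K - {0} \<Longrightarrow> \<epsilon> \<le> t"
    using fin \<open>T > 0\<close> by (auto simp: \<epsilon>_def K_def)
  have "fst (f t) \<notin> \<int>" if "t \<in> {0<..<\<epsilon>}" for t
    using \<epsilon>(2) \<epsilon>(3)[of t] that unfolding K_def by auto
  moreover have "continuous_on {0<..<\<epsilon>} (\<lambda>t. fst (f t))"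
    by (rule continuous_on_subset[OF edge_motion_continuous(2)[OF f]]) (use \<epsilon> in auto)
  ultimately show ?thesis
    using in_edge_const[of 0 \<epsilon> "\<lambda>t. fst (f t)"] \<epsilon>(1) that unfolding enters_def by metis
qed

text \<open>A continuation argument. Up to its first exit from the edge the motion agrees with the
  parabola, which is still inside the edge at that moment.\<close>

lemma edge_motion_follows_parabola:
  assumes f: "edge_motion F T f" and h: "0 < h" "h \<le> T"
    and ent: "enters (\<lambda>t. fst (f t)) n"
    and parabola: "\<And>t. t \<in> {0<..<h} \<Longrightarrow> in_edge n (fst (parabola (f 0) (F n) t))"
    and t: "t \<in> {0..h}"
  shows "f t = parabola (f 0) (F n) t"
proof (rule edge_motion_eq_parabola[OF f _ h(2) _ t])
  obtain \<epsilon> where \<epsilon>: "\<epsilon> > 0" "\<And>t. t \<in> {0<..<\<epsilon>} \<Longrightarrow> in_edge n (fst (f t))"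
    using ent unfolding enters_def by blast
  show "in_edge n (fst (f u))" if u: "u \<in> {0<..<h}" for u
  proof (rule ccontr)
    assume nu: "\<not> in_edge n (fst (f u))"
    \<comment> \<open>Starting at \<epsilon> keeps time 0, at which the motion may sit on a vertex,
      out of \<open>B\<close>. Since \<open>B\<close> is closed, the first exit time is
      attained.\<close>
    define B where "B = {v \<in> {\<epsilon>..u}. fst (f v) \<in> {..of_int n} \<union> {of_int n + 1..}}"
    have "\<epsilon> \<le> u" using \<epsilon>(2) nu u by force
    have cont: "continuous_on {\<epsilon>..u} (\<lambda>t. fst (f t))"
      by (rule continuous_on_subset[OF edge_motion_continuous(2)[OF f]]) (use \<epsilon>(1) u h in auto)
    have "B = {\<epsilon>..u} \<inter> (\<lambda>t. fst (f t)) -` ({..of_int n} \<union> {of_int n + 1..})"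
      unfolding B_def by blast
    then have "closed B" using continuous_closed_preimage[OF cont] by (metis closed_Un closed_atLeast closed_atLeastAtMost closed_atMost)
    moreover have "u \<in> B" using nu \<open>\<epsilon> \<le> u\<close> unfolding B_def in_edge_def by auto
    moreover have bdd: "bdd_below B" unfolding B_def by (rule bdd_belowI[of _ \<epsilon>]) auto
    ultimately have inf: "Inf B \<in> B" using closed_contains_Inf by blast
    define w where "w = Inf B"
    have w: "\<epsilon> \<le> w" "w \<le> u" "\<not> in_edge n (fst (f w))" using inf unfolding B_def w_def in_edge_def by auto
    have "in_edge n (fst (f v))" if "v \<in> {0<..<w}" for v
    proof (cases "v < \<epsilon>")
      case False
      then have "v \<notin> B" using that cInf_lower[OF _ bdd] unfolding w_def by force
      then show ?thesis using False that w unfolding B_def in_edge_def by auto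
    qed (use \<epsilon> that in auto)
    then have "f w = parabola (f 0) (F n) w"
      by (intro edge_motion_eq_parabola[OF f, where h = w]) (use w u h \<epsilon> in auto)
    then show False using parabola[of w] w u \<epsilon> by auto
  qed
qed (use h in auto)

section \<open>Concatenation and decomposition of motions\<close>

definition glue :: "real \<Rightarrow> real \<Rightarrow> (real \<Rightarrow> 'a) \<Rightarrow> (real \<Rightarrow> 'a) \<Rightarrow> real \<Rightarrow> 'a" where
  "glue T h f g = restrict (\<lambda>t. if t \<le> h then f t else g (t - h)) {0..T}"

lemma edge_motion_cong:
  assumes f: "edge_motion F T f" and eq: "\<And>t. t \<in> {0..T} \<Longrightarrow> f t = g t"
  shows "edge_motion F T g"
  unfolding edge_motion_def
proof (intro conjI ballI impI)
  show "continuous_on {0..T} g"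
    using continuous_on_eq[OF edge_motion_continuous(1)[OF f]] eq by blast
  have "{t \<in> {0..T}. fst (g t) \<in> \<int>} = {t \<in> {0..T}. fst (f t) \<in> \<int>}"
    using eq by auto
  then show "finite {t \<in> {0..T}. fst (g t) \<in> \<int>}"
    using f by (simp add: edge_motion_def)
  fix t assume t: "t \<in> {0..T}" and "fst (g t) \<notin> \<int>"
  then have "(f has_vector_derivative (snd (g t), F \<lfloor>fst (g t)\<rfloor>)) (at t within {0..T})"
    using f eq[OF t] t unfolding edge_motion_def by metis
  then show "(g has_vector_derivative (snd (g t), F \<lfloor>fst (g t)\<rfloor>)) (at t within {0..T})"
    by (rule has_vector_derivative_transform[OF t eq[symmetric], rotated])
qed

lemma has_vector_derivative_translate_within:
  fixes f :: "real \<Rightarrow> 'a::real_normed_vector"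
  assumes "(f has_vector_derivative d) (at (t + h) within (\<lambda>t. t + h) ` S)"
  shows "((\<lambda>t. f (t + h)) has_vector_derivative d) (at t within S)"
proof -
  have "((\<lambda>t. t + h) has_vector_derivative 1) (at t within S)"
    by (auto intro!: derivative_eq_intros)
  from vector_diff_chain_within[OF this assms] show ?thesis
    by (simp add: o_def)
qed

lemma edge_motion_shift:
  assumes f: "edge_motion F T f" and h: "0 \<le> h" "h \<le> T"
  shows "edge_motion F (T - h) (\<lambda>t. f (t + h))"
  unfolding edge_motion_def
proof (intro conjI ballI impI)
  have im: "(\<lambda>t. t + h) ` {0..T - h} \<subseteq> {0..T}" using h by auto
  show "continuous_on {0..T - h} (\<lambda>t. f (t + h))"
    by (rule continuous_on_compose2[OF edge_motion_continuous(1)[OF f] _ im]) (intro continuous_intros)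
  have "finite ((\<lambda>t. t - h) ` {t \<in> {0..T}. fst (f t) \<in> \<int>})"
    using f by (simp add: edge_motion_def)
  moreover have "t \<in> (\<lambda>t. t - h) ` {t \<in> {0..T}. fst (f t) \<in> \<int>}"
    if "t \<in> {0..T - h}" "fst (f (t + h)) \<in> \<int>" for t
    by (rule image_eqI[of _ _ "t + h"]) (use that h in auto)
  ultimately show "finite {t \<in> {0..T - h}. fst (f (t + h)) \<in> \<int>}"
    by (elim rev_finite_subset) auto
  fix t assume "t \<in> {0..T - h}" "fst (f (t + h)) \<notin> \<int>"
  then have "(f has_vector_derivative (snd (f (t + h)), F \<lfloor>fst (f (t + h))\<rfloor>)) (at (t + h) within {0..T})"
    using f h unfolding edge_motion_def by auto
  from has_vector_derivative_within_subset[OF this im]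
  show "((\<lambda>t. f (t + h)) has_vector_derivative (snd (f (t + h)), F \<lfloor>fst (f (t + h))\<rfloor>)) (at t within {0..T - h})"
    by (rule has_vector_derivative_translate_within)
qed

lemma edge_motion_glue:
  assumes f: "edge_motion F h f" and g: "edge_motion F (T - h) g"
    and h: "0 \<le> h" "h \<le> T" and match: "f h = g 0"
  shows "edge_motion F T (glue T h f g)"
proof -
  define k where "k = (\<lambda>t. if t \<in> {0..h} then f t else g (t - h))"
  have un: "{0..T} = {0..h} \<union> {h..T}" using h by auto
  have im: "(\<lambda>t. t - h) ` {h..T} = {0..T - h}"
    by simp
  have kg: "k t = g (t - h)" if "t \<in> {h..T}" for t
    using that match by (auto simp: k_def)
  have "edge_motion F T k"
    unfolding edge_motion_def
  proof (intro conjI ballI impI)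
    show "continuous_on {0..T} k"
      unfolding un
    proof (rule continuous_on_closed_Un)
      show "continuous_on {0..h} k"
        by (rule continuous_on_eq[OF edge_motion_continuous(1)[OF f]]) (simp add: k_def)
      have "continuous_on {h..T} (\<lambda>t. g (t - h))"
        by (rule continuous_on_compose2[OF edge_motion_continuous(1)[OF g]])
          (use im in \<open>auto intro!: continuous_intros\<close>)
      then show "continuous_on {h..T} k"
        by (rule continuous_on_eq) (simp add: kg)
    qed auto
    have "finite ({t \<in> {0..h}. fst (f t) \<in> \<int>} \<union> (\<lambda>t. t + h) ` {t \<in> {0..T - h}. fst (g t) \<in> \<int>})"
      using f g by (simp add: edge_motion_def)
    moreover have "t \<in> (\<lambda>t. t + h) ` {t \<in> {0..T - h}. fst (g t) \<in> \<int>}"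
      if "t \<in> {0..T}" "\<not> t \<le> h" "fst (g (t - h)) \<in> \<int>" for t
      by (rule image_eqI[of _ _ "t - h"]) (use that in auto)
    ultimately show "finite {t \<in> {0..T}. fst (k t) \<in> \<int>}"
      by (elim rev_finite_subset) (auto simp: k_def)
    fix t assume t: "t \<in> {0..T}" and ni: "fst (k t) \<notin> \<int>"
    \<comment> \<open>The required derivative is a function of the state alone, so the two pieces,
      which share the state at time \<open>h\<close>, agree there on the one-sided
      derivatives.\<close>
    define d where "d = (\<lambda>t. (snd (k t), F \<lfloor>fst (k t)\<rfloor>))"
    have "(k has_vector_derivative (if t \<in> {0..h} then d t else d t)) (at t within {0..T})"
      unfolding k_def
    proof (rule has_vector_derivative_If_within_closures[OF _ un])
      have cl: "closure {0..h} \<inter> closure {h..T} = {h}" using h by auto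
      show "t \<in> {0..h} \<union> {h..T}" using t un by simp
      show "(f has_vector_derivative d t) (at t within {0..h} \<union> closure {0..h} \<inter> closure {h..T})"
        if "t \<in> {0..h} \<union> closure {0..h} \<inter> closure {h..T}"
      proof -
        have "t \<in> {0..h}" "k t = f t" using that cl h by (auto simp: k_def)
        then have "(f has_vector_derivative d t) (at t within {0..h})"
          using f ni by (auto simp: edge_motion_def d_def)
        then show ?thesis using cl h by (simp add: insert_absorb)
      qed
      show "((\<lambda>t. g (t - h)) has_vector_derivative d t) (at t within {h..T} \<union> closure {0..h} \<inter> closure {h..T})"
        if "t \<in> {h..T} \<union> closure {0..h} \<inter> closure {h..T}"
      proof -
        have tt: "t \<in> {h..T}" "k t = g (t - h)" using that cl h kg by auto
        then have "t - h \<in> {0..T - h}" "fst (g (t - h)) \<notin> \<int>" using ni by auto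
        then have "(g has_vector_derivative d t) (at (t - h) within {0..T - h})"
          using g tt(2) unfolding edge_motion_def d_def by metis
        then have "((\<lambda>t. g (t + - h)) has_vector_derivative d t) (at t within {h..T})"
          unfolding im[symmetric] by (intro has_vector_derivative_translate_within) simp
        moreover have "{h..T} \<union> closure {0..h} \<inter> closure {h..T} = {h..T}" using cl h by auto
        ultimately show ?thesis by simp
      qed
    qed (use match in auto)
    then show "(k has_vector_derivative (snd (k t), F \<lfloor>fst (k t)\<rfloor>)) (at t within {0..T})"
      by (simp add: d_def)
  qed
  then show ?thesis
    by (rule edge_motion_cong) (simp add: k_def glue_def)
qed

lemma edge_motion_parabola:
  assumes "\<And>t. t \<in> {0<..<h} \<Longrightarrow> in_edge n (fst (parabola x (F n) t))"
    and "fst x \<in> \<int> \<or> in_edge n (fst x)" "fst (parabola x (F n) h) \<in> \<int> \<or> in_edge n (fst (parabola x (F n) h))"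
  shows "edge_motion F h (parabola x (F n))"
  unfolding edge_motion_def
proof (intro conjI ballI impI)
  have *: "t = 0 \<or> t = h \<or> in_edge n (fst (parabola x (F n) t))" if "t \<in> {0..h}" for t
    using assms(1)[of t] that by (cases "t = 0 \<or> t = h") auto
  have "{t \<in> {0..h}. fst (parabola x (F n) t) \<in> \<int>} \<subseteq> {0, h}"
    using * in_edge_not_Ints by blast
  then show "finite {t \<in> {0..h}. fst (parabola x (F n) t) \<in> \<int>}"
    using finite_subset by blast
  fix t assume "t \<in> {0..h}" "fst (parabola x (F n) t) \<notin> \<int>"
  then have "in_edge n (fst (parabola x (F n) t))" using *[of t] assms(2,3) by auto
  then show "(parabola x (F n) has_vector_derivative (snd (parabola x (F n) t), F \<lfloor>fst (parabola x (F n) t)\<rfloor>)) (at t within {0..h})"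
    using parabola_has_vector_derivative in_edge_floor by metis
qed (rule continuous_on_parabola)

text \<open>Within a single point every vector is a derivative, so the equation imposes nothing.
  This starts the induction.\<close>

lemma motions_0: "motions F x 0 = {restrict (\<lambda>_. x) {0..0}}"
proof -
  have "edge_motion F 0 (restrict (\<lambda>_. x) {0..0})"
    unfolding edge_motion_def
    by (auto simp: has_vector_derivative_def has_derivative_within_singleton_iff intro: bounded_linear_scaleR_left simp del: scaleR_Pair)
  then show ?thesis
    unfolding motions_def by (auto simp: extensional_def fun_eq_iff)
qed

text \<open>The recursion behind the counting of motions: once the edge is chosen, the motion is
  forced up to time \<open>h\<close> and only the remainder on \<open>T - h\<close> is free.\<close>

lemma motions_entering:
  assumes h: "0 < h" "h \<le> T"
    and parabola: "\<And>t. t \<in> {0<..<h} \<Longrightarrow> in_edge n (fst (parabola x (F n) t))"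
    and ends: "fst x \<in> \<int> \<or> in_edge n (fst x)" "fst (parabola x (F n) h) \<in> \<int> \<or> in_edge n (fst (parabola x (F n) h))"
  shows "{f \<in> motions F x T. enters (\<lambda>t. fst (f t)) n}
       = glue T h (parabola x (F n)) ` motions F (parabola x (F n) h) (T - h)"
proof (intro equalityI subsetI)
  fix f assume f: "f \<in> {f \<in> motions F x T. enters (\<lambda>t. fst (f t)) n}"
  then have m: "edge_motion F T f" and ext: "f \<in> extensional {0..T}" and f0: "f 0 = x"
    and ent: "enters (\<lambda>t. fst (f t)) n" by (auto simp: motions_def)
  have fa: "f t = parabola x (F n) t" if "t \<in> {0..h}" for t
    using edge_motion_follows_parabola[OF m h ent _ that] parabola f0 by simp
  define g where "g = restrict (\<lambda>t. f (t + h)) {0..T - h}"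
  have "edge_motion F (T - h) g"
    by (rule edge_motion_cong[OF edge_motion_shift[OF m]]) (use h in \<open>auto simp: g_def\<close>)
  then have "g \<in> motions F (parabola x (F n) h) (T - h)"
    using fa[of h] h unfolding motions_def by (simp add: g_def)
  moreover have "f = glue T h (parabola x (F n)) g"
    unfolding glue_def
  proof (rule extensionalityI[OF ext restrict_extensional])
    show "f t = restrict (\<lambda>t. if t \<le> h then parabola x (F n) t else g (t - h)) {0..T} t" if "t \<in> {0..T}" for t
      using that fa by (auto simp: g_def)
  qed
  ultimately show "f \<in> glue T h (parabola x (F n)) ` motions F (parabola x (F n) h) (T - h)" by blast
next
  fix f assume "f \<in> glue T h (parabola x (F n)) ` motions F (parabola x (F n) h) (T - h)"
  then obtain g where g: "edge_motion F (T - h) g" "g 0 = parabola x (F n) h" and f: "f = glue T h (parabola x (F n)) g"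
    by (auto simp: motions_def)
  have "edge_motion F T f"
    unfolding f by (rule edge_motion_glue[OF _ g(1)]) (use edge_motion_parabola[of h n x F] parabola ends h g in auto)
  moreover have "enters (\<lambda>t. fst (f t)) n"
    unfolding enters_def using h parabola by (intro exI[of _ h]) (auto simp: f glue_def)
  ultimately show "f \<in> {f \<in> motions F x T. enters (\<lambda>t. fst (f t)) n}"
    unfolding motions_def using h by (auto simp: f glue_def)
qed

text \<open>A motion entering edge \<open>n\<close> coincides for a while with the parabola of that
  edge, so the parabola enters \<open>n\<close> as well. The possible edges can thus be read off
  from \<open>x\<close> and \<open>F\<close>.\<close>

lemma motions_exits:
  assumes "T > 0"
  shows "motions F x T = (\<Union>n\<in>{n. enters (\<lambda>t. fst (parabola x (F n) t)) n}. {f \<in> motions F x T. enters (\<lambda>t. fst (f t)) n})"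
proof -
  have "\<exists>n. enters (\<lambda>t. fst (parabola x (F n) t)) n \<and> enters (\<lambda>t. fst (f t)) n" if "f \<in> motions F x T" for f
  proof -
    have m: "edge_motion F T f" and f0: "f 0 = x" using that by (auto simp: motions_def)
    obtain n where n: "enters (\<lambda>t. fst (f t)) n" using edge_motion_enters[OF m assms] .
    then obtain \<epsilon> where \<epsilon>: "\<epsilon> > 0" "\<And>t. t \<in> {0<..<\<epsilon>} \<Longrightarrow> in_edge n (fst (f t))"
      unfolding enters_def by blast
    have "f t = parabola x (F n) t" if "t \<in> {0..min \<epsilon> T}" for t
      unfolding f0[symmetric] by (rule edge_motion_eq_parabola[OF m _ _ _ that]) (use \<epsilon> assms in auto)
    then have "\<forall>t\<in>{0<..<min \<epsilon> T}. in_edge n (fst (parabola x (F n) t))"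
      using \<epsilon> by (metis atLeastAtMost_iff greaterThanLessThan_iff less_eq_real_def min_less_iff_conj)
    then have "enters (\<lambda>t. fst (parabola x (F n) t)) n"
      unfolding enters_def using \<epsilon>(1) assms by (intro exI[of _ "min \<epsilon> T"]) auto
    with n show ?thesis by blast
  qed
  then show ?thesis by auto
qed

section \<open>Conservation of energy and branching\<close>

text \<open>The condition \<open>u\<close> is the one under which solutions are unique; carrying it along lets a single
  induction prove existence, finiteness and uniqueness.\<close>

definition determined :: "bool \<Rightarrow> 'a set \<Rightarrow> bool" where
  "determined u S \<longleftrightarrow> finite S \<and> S \<noteq> {} \<and> (u \<longrightarrow> is_singleton S)"

lemma determined_image: "determined u S \<Longrightarrow> determined u (f ` S)"
  unfolding determined_def is_singleton_def by auto

lemma determined_UN: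
  assumes "determined u I" "\<And>i. i \<in> I \<Longrightarrow> determined u (S i)"
  shows "determined u (\<Union>i\<in>I. S i)"
proof -
  have "is_singleton (\<Union>i\<in>I. S i)" if u
  proof -
    obtain i where "I = {i}" using assms(1) \<open>u\<close> unfolding determined_def is_singleton_def by blast
    then show ?thesis using assms(2)[of i] that by (simp add: determined_def)
  qed
  then show ?thesis using assms unfolding determined_def by auto
qed

lemma determined_subset_doubleton:
  assumes "S \<subseteq> {a, b}" "S \<noteq> {}" "u \<Longrightarrow> \<not> (a \<in> S \<and> b \<in> S)"
  shows "determined u S"
proof -
  have "S = {a} \<or> S = {b}" if u
  proof (cases "a \<in> S")
    case True
    then have "b \<notin> S" using assms(3) that by blast
    then show ?thesis using True assms(1) by blast
  next
    case False
    then show ?thesis using assms(1,2) by blast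
  qed
  then show ?thesis
    unfolding determined_def is_singleton_def using assms(2) finite_subset[OF assms(1)] by blast
qed

lemma edge_endpoints:
  fixes s :: "real \<Rightarrow> real"
  assumes "continuous_on {0..h} s" "0 < h" "\<And>t. t \<in> {0<..<h} \<Longrightarrow> in_edge n (s t)" "t \<in> {0..h}"
  shows "of_int n \<le> s t" "s t \<le> of_int n + 1"
proof -
  have cl: "closure {0<..<h} = {0..h}" using \<open>0 < h\<close> by (simp add: closure_greaterThanLessThan)
  show "of_int n \<le> s t"
    by (rule continuous_ge_on_closure[of "{0<..<h}"]) (use assms cl in \<open>auto simp: in_edge_def less_imp_le\<close>)
  show "s t \<le> of_int n + 1"
    by (rule continuous_le_on_closure[of "{0<..<h}"]) (use assms cl in \<open>auto simp: in_edge_def less_imp_le\<close>)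
qed

lemma continuous_on_fst_parabola: "continuous_on S (\<lambda>t. fst (parabola x k t))"
  by (intro continuous_intros continuous_on_parabola)

lemma enters_parabola_inside:
  assumes "in_edge m (fst x)"
  shows "enters (\<lambda>t. fst (parabola x k t)) n \<Longrightarrow> n = m" "enters (\<lambda>t. fst (parabola x k t)) m"
proof -
  have "isCont (\<lambda>t. fst (parabola x k t)) 0"
    using continuous_on_fst_parabola[of UNIV x k] by (simp add: continuous_on_eq_continuous_at)
  then have "\<forall>\<^sub>F t in at 0. fst (parabola x k t) \<in> {of_int m<..<of_int m + 1}"
    unfolding isCont_def by (rule topological_tendstoD) (use assms in \<open>auto simp: in_edge_def\<close>)
  then obtain \<delta> where \<delta>: "\<delta> > 0" "\<And>t. t \<noteq> 0 \<Longrightarrow> \<bar>t\<bar> < \<delta> \<Longrightarrow> in_edge m (fst (parabola x k t))"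
    unfolding eventually_at in_edge_def dist_real_def by auto
  then show "enters (\<lambda>t. fst (parabola x k t)) m" unfolding enters_def by (intro exI[of _ \<delta>]) auto
  assume "enters (\<lambda>t. fst (parabola x k t)) n"
  then obtain \<epsilon> where \<epsilon>: "\<epsilon> > 0" "\<And>t. t \<in> {0<..<\<epsilon>} \<Longrightarrow> in_edge n (fst (parabola x k t))"
    unfolding enters_def by blast
  define t where "t = min \<epsilon> \<delta> / 2"
  have "in_edge n (fst (parabola x k t))" "in_edge m (fst (parabola x k t))"
    using \<epsilon> \<delta> by (auto simp: t_def)
  then show "n = m" using in_edge_floor by metis
qed

text \<open>After division by \<open>t\<close> the factor \<open>c + k * t / 2\<close> is positive
  near 0, so its limit \<open>c\<close> is not negative, and for \<open>c = 0\<close> the force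
  decides.\<close>

lemma positive_start:
  fixes c k :: real
  assumes "\<epsilon> > 0" "\<And>t. t \<in> {0<..<\<epsilon>} \<Longrightarrow> c * t + k * t\<^sup>2 / 2 > 0"
  shows "c > 0 \<or> c = 0 \<and> k > 0"
proof -
  have *: "c + k * t / 2 > 0" if "t \<in> {0<..<\<epsilon>}" for t
  proof -
    have "t * (c + k * t / 2) > 0" using assms(2)[OF that] by (simp add: algebra_simps power2_eq_square)
    then show ?thesis using that by (simp add: zero_less_mult_iff)
  qed
  have False if "c < 0"
  proof -
    \<comment> \<open>Chosen so that \<open>k * t \<le> - c\<close>, hence
      \<open>c + k * t / 2 \<le> c / 2 < 0\<close>, within the interval of positivity.\<close>
    define t where "t = min (\<epsilon> / 2) (- c / (\<bar>k\<bar> + 1))"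
    have t: "t > 0" "t < \<epsilon>" "t \<le> - c / (\<bar>k\<bar> + 1)" using assms(1) that by (auto simp: t_def divide_neg_pos)
    have "k * t \<le> (\<bar>k\<bar> + 1) * t" using t by (intro mult_right_mono) auto
    also have "\<dots> \<le> - c" using t(3) by (simp add: field_simps)
    finally show False using *[of t] t that by simp
  qed
  moreover have "k > 0" if "c = 0" using *[of "\<epsilon> / 2"] assms(1) that by (simp add: zero_less_mult_iff)
  ultimately show ?thesis by force
qed

text \<open>Think of \<open>M\<close> as a bound of the force, \<open>C\<close> of the speed, and
  \<kappa> as the least nonzero speed. \<open>M * \<tau> \<le> \<kappa>\<close> lets the force
  consume at most half of the speed, so there is no turning back;
  \<open>(C + M) * \<tau> \<le> 1 / 2\<close> excludes reaching the next vertex. From rest the force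
  itself drives the point away.\<close>

lemma positive_arc_bounds:
  fixes c k :: real
  assumes dir: "c > 0 \<or> c = 0 \<and> k > 0"
    and bd: "\<bar>k\<bar> \<le> M" "\<bar>c\<bar> \<le> C" "c \<noteq> 0 \<Longrightarrow> \<kappa> \<le> \<bar>c\<bar>" "\<kappa> > 0"
    and \<tau>: "\<tau> \<le> 1" "M * \<tau> \<le> \<kappa>" "(C + M) * \<tau> \<le> 1 / 2"
    and t: "0 < t" "t \<le> \<tau>"
  shows "0 < c * t + k * t\<^sup>2 / 2" "c * t + k * t\<^sup>2 / 2 < 1"
proof -
  have eq: "c * t + k * t\<^sup>2 / 2 = t * (c + k * t / 2)" by (simp add: algebra_simps power2_eq_square)
  have kt: "\<bar>k\<bar> * t \<le> M * \<tau>" by (rule mult_mono) (use bd t in auto)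
  have "\<bar>k * t\<bar> = \<bar>k\<bar> * t" using t by (simp add: abs_mult)
  then have kt': "- (\<bar>k\<bar> * t) \<le> k * t" "k * t \<le> \<bar>k\<bar> * t" by linarith+
  have "c + k * t / 2 > 0"
  proof (cases "c = 0")
    case True
    then show ?thesis using dir t by simp
  next
    case False
    then have "c \<ge> \<kappa>" using dir bd by auto
    then show ?thesis using kt kt' \<tau> bd(4) by linarith
  qed
  then show "0 < c * t + k * t\<^sup>2 / 2" unfolding eq using t by simp
  have "c * t \<le> C * \<tau>" by (rule mult_mono) (use bd t in auto)
  moreover have "k * t * t \<le> M * \<tau> * 1"
    by (rule mult_mono[OF order_trans[OF kt'(2) kt]]) (use t \<tau> bd in auto)
  moreover have "0 \<le> M * \<tau>" using bd t by auto
  ultimately show "c * t + k * t\<^sup>2 / 2 < 1"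
    using \<tau>(3) by (simp add: algebra_simps power2_eq_square)
qed

text \<open>The two finiteness conditions, which periodicity will supply, make the bounds of speed
  and force uniform over all vertices of a level.\<close>

locale edge_potential =
  fixes F :: "int \<Rightarrow> real" and U :: "real \<Rightarrow> real"
  assumes continuous_U: "continuous_on UNIV U"
    and U_edge: "\<And>n s. of_int n \<le> s \<Longrightarrow> s \<le> of_int n + 1 \<Longrightarrow> U s = U (of_int n) - F n * (s - of_int n)"
    and finite_F: "finite (range F)" and finite_U: "finite (range (\<lambda>n::int. U (of_int n)))"
begin

definition energy_at :: "real \<times> real \<Rightarrow> real" where
  "energy_at x = (snd x)\<^sup>2 / 2 + U (fst x)"

lemma energy_at_parabola:
  assumes "of_int n \<le> fst x" "fst x \<le> of_int n + 1"
    and "of_int n \<le> fst (parabola x (F n) t)" "fst (parabola x (F n) t) \<le> of_int n + 1"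
  shows "energy_at (parabola x (F n) t) = energy_at x"
  unfolding energy_at_def U_edge[OF assms(1,2)] U_edge[OF assms(3,4)]
  by (simp add: parabola_def power2_eq_square field_simps)

lemma energy_at_conserved:
  assumes f: "edge_motion F T f" and t: "t \<in> {0..T}"
  shows "energy_at (f t) = energy_at (f 0)"
proof (rule const_if_zero_derivative[OF _ _ _ t])
  define K where "K = {t \<in> {0..T}. fst (f t) \<in> \<int>}"
  show "finite K" using f by (simp add: edge_motion_def K_def)
  note cont = edge_motion_continuous[OF f]
  show "continuous_on {0..T} (\<lambda>t. energy_at (f t))"
    unfolding energy_at_def
    by (intro continuous_intros cont continuous_on_compose2[OF continuous_U]) auto
  fix s assume s: "s \<in> {0..T} - K"
  define n where "n = \<lfloor>fst (f s)\<rfloor>"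
  have n: "in_edge n (fst (f s))" using s in_edge_if_not_Ints by (auto simp: n_def K_def)
  have "(f has_vector_derivative (snd (f s), F n)) (at s within {0..T})"
    using f s unfolding edge_motion_def K_def n_def by blast
  note d = has_vector_derivative_fst_snd[OF this]
  have "((\<lambda>s. U (of_int n) - F n * (s - of_int n)) has_real_derivative - F n) (at (fst (f s)))"
    by (auto intro!: derivative_eq_intros)
  then have "(U has_real_derivative - F n) (at (fst (f s)))"
  proof (rule has_field_derivative_transform_within_open)
    show "open {of_int n <..< of_int n + (1::real)}" by simp
    show "U (of_int n) - F n * (s - of_int n) = U s" if "s \<in> {of_int n <..< of_int n + 1}" for s
      using U_edge[of n s] that by simp
  qed (use n in \<open>simp add: in_edge_def\<close>)
  from DERIV_chain2[OF this d(1)]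
  have "((\<lambda>s. U (fst (f s))) has_real_derivative - F n * snd (f s)) (at s within {0..T})" .
  moreover have "((\<lambda>s. (snd (f s))\<^sup>2 / 2) has_real_derivative snd (f s) * F n) (at s within {0..T})"
    by (rule DERIV_cong[OF DERIV_cdivide[OF DERIV_power[OF d(2)]]]) simp
  ultimately show "((\<lambda>t. energy_at (f t)) has_real_derivative 0) (at s within {0..T})"
    unfolding energy_at_def by (auto dest: DERIV_add)
qed

text \<open>On a fixed level the speed at a vertex is \<open>sqrt (2 * (E - U))\<close>, one of
  finitely many numbers, so the nonzero speeds have a positive minimum. This excludes infinitely
  many switchings in finite time.\<close>

lemma minimal_switching_time:
  "\<exists>\<tau>>0. \<forall>n c t. energy_at (of_int n, c) = E \<longrightarrow> t \<in> {0<..\<tau>} \<longrightarrow>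
     (c > 0 \<or> c = 0 \<and> F n > 0 \<longrightarrow> in_edge n (fst (parabola (of_int n, c) (F n) t))) \<and>
     (c < 0 \<or> c = 0 \<and> F (n - 1) < 0 \<longrightarrow> in_edge (n - 1) (fst (parabola (of_int n, c) (F (n - 1)) t)))"
proof -
  \<comment> \<open>Vertices with \<open>U > E\<close> contribute negative values, as
    \<open>sqrt\<close> is odd; the condition \<open>a > 0\<close> in \<kappa> discards
    them.\<close>
  define A where "A = range (\<lambda>n::int. sqrt (2 * (E - U (of_int n))))"
  have "A = (\<lambda>u. sqrt (2 * (E - u))) ` range (\<lambda>n::int. U (of_int n))"
    unfolding A_def by auto
  then have finA: "finite A" using finite_U by simp
  have speed: "\<bar>c\<bar> \<in> A" if "energy_at (of_int n, c) = E" for n c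
  proof -
    have "c\<^sup>2 = 2 * (E - U (of_int n))" using that by (auto simp: energy_at_def field_simps)
    then have "\<bar>c\<bar> = sqrt (2 * (E - U (of_int n)))" by (metis real_sqrt_abs)
    then show ?thesis unfolding A_def by blast
  qed
  \<comment> \<open>Inserting 1 keeps the sets nonempty and gives \<open>C \<ge> 1\<close> and
    \<open>M \<ge> 1\<close>, so that the quotients in \<tau> are positive.\<close>
  define C where "C = Max (insert 1 A)"
  define \<kappa> where "\<kappa> = Min (insert 1 {a \<in> A. a > 0})"
  define M where "M = Max (insert 1 (abs ` range F))"
  have C: "a \<le> C" if "a \<in> A" for a using that finA by (simp add: C_def)
  have C1: "C \<ge> 1" using finA by (simp add: C_def)
  have \<kappa>: "\<kappa> > 0" "\<And>a. a \<in> A \<Longrightarrow> a > 0 \<Longrightarrow> \<kappa> \<le> a" using finA by (auto simp: \<kappa>_def)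
  have M: "\<bar>F n\<bar> \<le> M" for n unfolding M_def using finite_F by (intro Max_ge) auto
  have M1: "M \<ge> 1" using finite_F by (simp add: M_def)
  define \<tau> where "\<tau> = min 1 (min (\<kappa> / M) (1 / (2 * (C + M))))"
  have \<tau>: "\<tau> > 0" "\<tau> \<le> 1" "\<tau> \<le> \<kappa> / M" "\<tau> \<le> 1 / (2 * (C + M))" using \<kappa> M1 C1 by (auto simp: \<tau>_def)
  have \<tau>': "M * \<tau> \<le> \<kappa>" "(C + M) * \<tau> \<le> 1 / 2"
    using \<tau>(3,4) M1 C1 by (auto simp: field_simps)
  show ?thesis
  proof (intro exI[of _ \<tau>] conjI[OF \<tau>(1)] allI impI conjI)
    fix n c t assume E: "energy_at (of_int n, c) = E" and t: "t \<in> {0<..\<tau>}"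
    have c: "\<bar>c\<bar> \<le> C" "c \<noteq> 0 \<Longrightarrow> \<kappa> \<le> \<bar>c\<bar>" using speed[OF E] C \<kappa> by auto
    show "in_edge n (fst (parabola (of_int n, c) (F n) t))" if "c > 0 \<or> c = 0 \<and> F n > 0"
      using positive_arc_bounds[OF that M c \<kappa>(1) \<tau>(2) \<tau>'] t by (simp add: in_edge_def parabola_def)
    \<comment> \<open>Motion to the left is motion to the right with speed and force
      negated.\<close>
    show "in_edge (n - 1) (fst (parabola (of_int n, c) (F (n - 1)) t))" if "c < 0 \<or> c = 0 \<and> F (n - 1) < 0"
      using positive_arc_bounds[of "-c" "- F (n - 1)" M C \<kappa> \<tau> t] that M[of "n - 1"] c \<kappa>(1) \<tau>(2) \<tau>' t
      by (simp add: in_edge_def parabola_def)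
  qed
qed

text \<open>By continuity the vertex is an end of edge \<open>m\<close>, which leaves two edges; the
  leading term of the displacement decides about each.\<close>

lemma enters_from_vertex:
  assumes "enters (\<lambda>t. fst (parabola (of_int n, c) (F m) t)) m"
  shows "m = n \<and> (c > 0 \<or> c = 0 \<and> F n > 0) \<or> m = n - 1 \<and> (c < 0 \<or> c = 0 \<and> F (n - 1) < 0)"
proof -
  obtain \<epsilon> where \<epsilon>: "\<epsilon> > 0" "\<And>t. t \<in> {0<..<\<epsilon>} \<Longrightarrow> in_edge m (fst (parabola (of_int n, c) (F m) t))"
    using assms unfolding enters_def by blast
  have "of_int m \<le> fst (parabola (of_int n, c) (F m) 0)" "fst (parabola (of_int n, c) (F m) 0) \<le> of_int m + 1"
    by (rule edge_endpoints[OF continuous_on_fst_parabola \<epsilon>]; use \<epsilon>(1) in simp)+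
  then consider "m = n" | "m = n - 1" by (simp, linarith)
  then show ?thesis
  proof cases
    case 1
    then show ?thesis
      using positive_start[OF \<epsilon>(1), of c "F n"] \<epsilon>(2) by (auto simp: in_edge_def parabola_def)
  next
    case 2
    then show ?thesis
      using positive_start[OF \<epsilon>(1), of "- c" "- F (n - 1)"] \<epsilon>(2) by (force simp: in_edge_def parabola_def)
  qed
qed

text \<open>From an inner point the time to the next vertex has no uniform lower bound, so it is
  obtained as a first exit time, cut off at \<open>T\<close>.\<close>

lemma exit_time:
  assumes "in_edge n (fst x)" "T > 0"
  obtains h where "0 < h" "h \<le> T" "\<And>t. t \<in> {0<..<h} \<Longrightarrow> in_edge n (fst (parabola x k t))"
    "h < T \<Longrightarrow> fst (parabola x k h) \<in> \<int>"
    "fst (parabola x k h) \<in> \<int> \<or> in_edge n (fst (parabola x k h))"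
proof (cases "\<forall>t\<in>{0..T}. in_edge n (fst (parabola x k t))")
  case True
  then show ?thesis using that[of T] \<open>T > 0\<close> by auto
next
  case False
  define G where "G = {t \<in> {0..T}. fst (parabola x k t) \<in> {..of_int n} \<union> {of_int n + 1..}}"
  have "G = {0..T} \<inter> (\<lambda>t. fst (parabola x k t)) -` ({..of_int n} \<union> {of_int n + 1..})"
    unfolding G_def by blast
  then have "closed G"
    using continuous_closed_preimage[OF continuous_on_fst_parabola]
    by (metis closed_Un closed_atLeast closed_atLeastAtMost closed_atMost)
  moreover have "G \<noteq> {}" using False unfolding G_def in_edge_def by force
  moreover have bdd: "bdd_below G" unfolding G_def by (rule bdd_belowI[of _ 0]) auto
  ultimately have inf: "Inf G \<in> G" using closed_contains_Inf by blast
  define h where "h = Inf G"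
  have h: "0 \<le> h" "h \<le> T" "\<not> in_edge n (fst (parabola x k h))"
    using inf unfolding G_def h_def in_edge_def by auto
  have "h > 0" using h assms(1) by (metis less_eq_real_def parabola_0)
  have inside: "in_edge n (fst (parabola x k t))" if "t \<in> {0<..<h}" for t
  proof -
    have "t \<notin> G" using that cInf_lower[OF _ bdd] unfolding h_def by force
    then show ?thesis using that h unfolding G_def in_edge_def by auto
  qed
  have "of_int n \<le> fst (parabola x k h)" "fst (parabola x k h) \<le> of_int n + 1"
    by (rule edge_endpoints[OF continuous_on_fst_parabola \<open>h > 0\<close> inside]; use h in simp)+
  then have "fst (parabola x k h) = of_int n \<or> fst (parabola x k h) = of_int (n + 1)"
    using h(3) unfolding in_edge_def by auto
  then have "fst (parabola x k h) \<in> \<int>" by (metis Ints_of_int)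
  then show ?thesis using that[of h] h \<open>h > 0\<close> inside by blast
qed

text \<open>Induction on the number of time steps \<tau> that cover \<open>[0, T]\<close>. Both
  conditions on vertices concern \<open>U = E\<close> only: elsewhere on the level a vertex is
  passed with nonzero speed, whose sign selects the edge.\<close>

theorem motions_determined:
  assumes live: "\<And>n::int. U (of_int n) = E \<Longrightarrow> F n > 0 \<or> F (n - 1) < 0"
    and unique: "\<And>n::int. u \<Longrightarrow> U (of_int n) = E \<Longrightarrow> \<not> (F n > 0 \<and> F (n - 1) < 0)"
    and "energy_at x = E" "T \<ge> 0"
  shows "determined u (motions F x T)"
proof -
  obtain \<tau> where \<tau>: "\<tau> > 0"
    "\<And>n c t. energy_at (of_int n, c) = E \<Longrightarrow> t \<in> {0<..\<tau>} \<Longrightarrow> c > 0 \<or> c = 0 \<and> F n > 0 \<Longrightarrow>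
       in_edge n (fst (parabola (of_int n, c) (F n) t))"
    "\<And>n c t. energy_at (of_int n, c) = E \<Longrightarrow> t \<in> {0<..\<tau>} \<Longrightarrow> c < 0 \<or> c = 0 \<and> F (n - 1) < 0 \<Longrightarrow>
       in_edge (n - 1) (fst (parabola (of_int n, c) (F (n - 1)) t))"
    using minimal_switching_time[of E] by metis
  have zero: "determined u (motions F x 0)" for x
    by (simp add: motions_0 determined_def)
  \<comment> \<open>One leg of the motion. The energy of its end point stands as a premise in
    \<open>step\<close>, so that conservation along the leg is proved here once for all
    uses.\<close>
  have exits: "determined u (motions F x T)"
    if "T > 0" "energy_at x = E" "determined u {n. enters (\<lambda>t. fst (parabola x (F n) t)) n}"
      and step: "\<And>n. enters (\<lambda>t. fst (parabola x (F n) t)) n \<Longrightarrow> \<exists>h. 0 < h \<and> h \<le> T \<and>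
        (\<forall>t\<in>{0<..<h}. in_edge n (fst (parabola x (F n) t))) \<and>
        (fst (parabola x (F n) h) \<in> \<int> \<or> in_edge n (fst (parabola x (F n) h))) \<and>
        (energy_at (parabola x (F n) h) = E \<longrightarrow> determined u (motions F (parabola x (F n) h) (T - h)))"
    for x T
  proof (subst motions_exits[OF that(1)], rule determined_UN[OF that(3)])
    fix n assume "n \<in> {n. enters (\<lambda>t. fst (parabola x (F n) t)) n}"
    then obtain h where h: "0 < h" "h \<le> T" "\<And>t. t\<in>{0<..<h} \<Longrightarrow> in_edge n (fst (parabola x (F n) t))"
        "fst (parabola x (F n) h) \<in> \<int> \<or> in_edge n (fst (parabola x (F n) h))"
        "energy_at (parabola x (F n) h) = E \<longrightarrow> determined u (motions F (parabola x (F n) h) (T - h))"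
      using step[of n] by auto
    note cl = edge_endpoints[OF continuous_on_fst_parabola h(1,3)]
    have x: "of_int n \<le> fst x" "fst x \<le> of_int n + 1" using cl[of 0] h(1) by auto
    then have "fst x = of_int n \<or> fst x = of_int (n + 1) \<or> in_edge n (fst x)"
      unfolding in_edge_def by auto
    then have "fst x \<in> \<int> \<or> in_edge n (fst x)" by (metis Ints_of_int)
    then have *: "{f \<in> motions F x T. enters (\<lambda>t. fst (f t)) n}
        = glue T h (parabola x (F n)) ` motions F (parabola x (F n) h) (T - h)"
      by (intro motions_entering) (use h in auto)
    have "energy_at (parabola x (F n) h) = E"
      using energy_at_parabola[OF x cl] h(1) that(2) by simp
    then show "determined u {f \<in> motions F x T. enters (\<lambda>t. fst (f t)) n}"
      using determined_image[of u "motions F (parabola x (F n) h) (T - h)" "glue T h (parabola x (F n))"] h(5)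
      by (simp add: *)
  qed
  have main: "determined u (motions F x T)" if "energy_at x = E" "0 \<le> T" "T \<le> real N * \<tau>" for N x T
    using that
  proof (induction N arbitrary: x T)
    case 0
    then show ?case using zero by simp
  next
    case (Suc N)
    \<comment> \<open>Stated for the full bound \<open>Suc N\<close>: the first leg from an inner
      point may be arbitrarily short, and after it the vertex case has to apply without a decrease
      of \<open>N\<close>.\<close>
    have vertex: "determined u (motions F (of_int n, c) T)"
      if E: "energy_at (of_int n, c) = E" and T: "0 \<le> T" "T \<le> real (Suc N) * \<tau>" for n c T
    proof (cases "T = 0")
      case True
      then show ?thesis using zero by simp
    next
      case False
      show ?thesis
      proof (rule exits)
        show "T > 0" using False T by simp
        have *: "enters (\<lambda>t. fst (parabola (of_int n, c) (F n) t)) n" if "c > 0 \<or> c = 0 \<and> F n > 0"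
          unfolding enters_def using \<tau>(1) \<tau>(2)[OF E _ that] by (intro exI[of _ \<tau>]) auto
        have **: "enters (\<lambda>t. fst (parabola (of_int n, c) (F (n - 1)) t)) (n - 1)" if "c < 0 \<or> c = 0 \<and> F (n - 1) < 0"
          unfolding enters_def using \<tau>(1) \<tau>(3)[OF E _ that] by (intro exI[of _ \<tau>]) auto
        let ?N = "{m. enters (\<lambda>t. fst (parabola (of_int n, c) (F m) t)) m}"
        have sub: "?N \<subseteq> {n - 1, n}" using enters_from_vertex by auto
        have zE: "U (of_int n) = E" if "c = 0" using E that by (simp add: energy_at_def)
        have "?N \<noteq> {}" using * ** live[OF zE] by force
        moreover have "\<not> (n \<in> ?N \<and> n - 1 \<in> ?N)" if u
          using unique[OF that zE] enters_from_vertex[of n c n] enters_from_vertex[of n c "n - 1"] by auto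
        ultimately show "determined u ?N"
          using determined_subset_doubleton[OF sub] by auto
        show "\<exists>h. 0 < h \<and> h \<le> T \<and>
          (\<forall>t\<in>{0<..<h}. in_edge m (fst (parabola (of_int n, c) (F m) t))) \<and>
          (fst (parabola (of_int n, c) (F m) h) \<in> \<int> \<or> in_edge m (fst (parabola (of_int n, c) (F m) h))) \<and>
          (energy_at (parabola (of_int n, c) (F m) h) = E \<longrightarrow>
             determined u (motions F (parabola (of_int n, c) (F m) h) (T - h)))"
          if m: "enters (\<lambda>t. fst (parabola (of_int n, c) (F m) t)) m" for m
        proof -
          \<comment> \<open>The leg is cut at \<tau> even though the motion may still be inside the
            edge; the induction hypothesis accepts any point of the level.\<close>
          define h where "h = min \<tau> T"
          have h: "0 < h" "h \<le> T" "h \<le> \<tau>" "0 \<le> T - h" "T - h \<le> real N * \<tau>"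
            using \<tau>(1) T False by (auto simp: h_def min_def algebra_simps)
          have "in_edge m (fst (parabola (of_int n, c) (F m) t))" if "t \<in> {0<..\<tau>}" for t
            using enters_from_vertex[OF m] \<tau>(2,3)[OF E that] by blast
          then show ?thesis
            using h Suc.IH by (intro exI[of _ h]) auto
        qed
      qed (use E in simp)
    qed
    show ?case
    proof (cases "fst x \<in> \<int>")
      case True
      then obtain n where "x = (of_int n, snd x)" by (metis Ints_cases prod.collapse)
      then show ?thesis using vertex[of n "snd x" T] Suc.prems by simp
    next
      case False
      show ?thesis
      proof (cases "T = 0")
        case True
        then show ?thesis using zero by simp
      next
        case T: False
        define n where "n = \<lfloor>fst x\<rfloor>"
        have n: "in_edge n (fst x)" using in_edge_if_not_Ints[OF False] by (simp add: n_def)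
        show ?thesis
        proof (rule exits[OF _ Suc.prems(1)])
          show "T > 0" using T Suc.prems by simp
          have "{m. enters (\<lambda>t. fst (parabola x (F m) t)) m} = {n}"
            using enters_parabola_inside[OF n] by blast
          then show "determined u {m. enters (\<lambda>t. fst (parabola x (F m) t)) m}"
            by (simp add: determined_def)
          fix m assume "enters (\<lambda>t. fst (parabola x (F m) t)) m"
          then have m: "m = n" using enters_parabola_inside[OF n] by blast
          obtain h where h: "0 < h" "h \<le> T" "\<And>t. t \<in> {0<..<h} \<Longrightarrow> in_edge n (fst (parabola x (F n) t))"
            "h < T \<Longrightarrow> fst (parabola x (F n) h) \<in> \<int>"
            "fst (parabola x (F n) h) \<in> \<int> \<or> in_edge n (fst (parabola x (F n) h))"
            using exit_time[OF n \<open>T > 0\<close>] by blast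
          have "determined u (motions F (parabola x (F n) h) (T - h))" if E: "energy_at (parabola x (F n) h) = E"
          proof (cases "h = T")
            case True
            then show ?thesis using zero by simp
          next
            case False
            then obtain i where "parabola x (F n) h = (of_int i, snd (parabola x (F n) h))"
              using h(2) h(4)[THEN Ints_cases] False by (metis prod.collapse less_eq_real_def)
            then show ?thesis
              using vertex[of i "snd (parabola x (F n) h)" "T - h"] E h Suc.prems by simp
          qed
          then show "\<exists>h. 0 < h \<and> h \<le> T \<and>
            (\<forall>t\<in>{0<..<h}. in_edge m (fst (parabola x (F m) t))) \<and>
            (fst (parabola x (F m) h) \<in> \<int> \<or> in_edge m (fst (parabola x (F m) h))) \<and>
            (energy_at (parabola x (F m) h) = E \<longrightarrow> determined u (motions F (parabola x (F m) h) (T - h)))"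
            unfolding m using h by blast
        qed
      qed
    qed
  qed
  obtain N :: nat where "T / \<tau> \<le> real N" using real_arch_simple by blast
  then have "T \<le> real N * \<tau>" using \<tau>(1) by (simp add: field_simps)
  then show ?thesis using main assms by blast
qed

text \<open>Equilibria inside a flat edge. They can lie on a level whose vertices have no exit,
  where \<open>motions_determined\<close> does not apply.\<close>

lemma motions_at_rest:
  assumes "in_edge n s" "F n = 0" "T \<ge> 0"
  shows "determined u (motions F (s, 0) T)"
proof (cases "T = 0")
  case True
  then show ?thesis by (simp add: motions_0 determined_def)
next
  case False
  have rest: "parabola (s, 0) (F n) t = (s, 0)" for t using assms(2) by (simp add: parabola_def)
  have "{m. enters (\<lambda>t. fst (parabola (s, 0) (F m) t)) m} = {n}"
    using enters_parabola_inside[of n "(s, 0)"] assms(1) by auto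
  then have "motions F (s, 0) T = {f \<in> motions F (s, 0) T. enters (\<lambda>t. fst (f t)) n}"
    using motions_exits[of T F "(s, 0)"] False assms by auto
  also have "\<dots> = glue T T (parabola (s, 0) (F n)) ` motions F (s, 0) 0"
    using motions_entering[of T T n "(s, 0)" F] False assms rest by auto
  finally show ?thesis
    using determined_image[of u "motions F (s, 0) 0"] by (simp add: motions_0 determined_def)
qed

lemma motions_extend:
  assumes "\<And>n::int. U (of_int n) = E \<Longrightarrow> F n > 0 \<or> F (n - 1) < 0"
    and "energy_at x = E" "0 \<le> t" "t \<le> T" and f: "f \<in> motions F x t"
  obtains g where "g \<in> motions F x T" "restrict g {0..t} = f"
proof -
  have m: "edge_motion F t f" and f0: "f 0 = x" and ext: "f \<in> extensional {0..t}"
    using f by (auto simp: motions_def)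
  have "energy_at (f t) = E" using energy_at_conserved[OF m] f0 assms by simp
  \<comment> \<open>Only existence is taken from here: by conservation the final state lies on the
    same level, so a continuation starts from it.\<close>
  then have "determined False (motions F (f t) (T - t))"
    by (intro motions_determined[where E = E]) (use assms in auto)
  then obtain g where g: "edge_motion F (T - t) g" "g 0 = f t"
    unfolding determined_def motions_def by blast
  have "edge_motion F T (glue T t f g)"
    by (rule edge_motion_glue[OF m g(1)]) (use g assms in auto)
  then have "glue T t f g \<in> motions F x T"
    using assms f0 by (simp add: motions_def glue_def)
  moreover have "restrict (glue T t f g) {0..t} = f"
    by (rule extensionalityI[OF restrict_extensional ext]) (use assms in \<open>auto simp: glue_def\<close>)
  ultimately show ?thesis using that by blast
qed

end

section \<open>Unrolling the square\<close>

text \<open>The coordinates \<open>h\<^sub>1\<close> and \<open>h\<^sub>2\<close> along the unrolled square are triangle waves.\<close>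

definition square_a :: "real \<Rightarrow> real" where "square_a s = 2 / pi * arcsin (cos (pi * s / 2))"
definition square_b :: "real \<Rightarrow> real" where "square_b s = 2 / pi * arcsin (sin (pi * s / 2))"

text \<open>The values of \<open>sgn h1 * p + sgn h2 * r\<close> on the successive sides, whose sign
  patterns are \<open>(+,+)\<close>, \<open>(-,+)\<close>, \<open>(-,-)\<close>,
  \<open>(+,-)\<close>.\<close>

definition edge_force :: "real \<Rightarrow> real \<Rightarrow> int \<Rightarrow> real" where
  "edge_force p r n = (if n mod 4 = 0 then p + r else if n mod 4 = 1 then r - p
     else if n mod 4 = 2 then - (p + r) else p - r)"

text \<open>The part \<open>h1 * h5 - h2 * h4\<close> of \<open>energy\<close>, with
  \<open>p = h4\<close> and \<open>r = h5\<close>.\<close>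

definition potential :: "real \<Rightarrow> real \<Rightarrow> real \<Rightarrow> real" where
  "potential p r s = square_a s * r - square_b s * p"

lemma square_periodic:
  "square_a (s - 4 * of_int m) = square_a s" "square_b (s - 4 * of_int m) = square_b s"
proof -
  have "pi * (s - 4 * of_int m) / 2 = pi * s / 2 - of_int m * (2 * pi)" by (simp add: field_simps)
  moreover have "cos (x - of_int m * (2 * pi)) = cos x" "sin (x - of_int m * (2 * pi)) = sin x" for x
    using cos_int_2pin[of m] sin_int_2pin[of m] by (simp_all add: cos_diff sin_diff ac_simps)
  ultimately show "square_a (s - 4 * of_int m) = square_a s" "square_b (s - 4 * of_int m) = square_b s"
    unfolding square_a_def square_b_def by (simp_all only:)
qed

text \<open>Each linear piece arises from a shift or reflection that moves the argument into
  \<open>[-1, 1]\<close>, where \<open>arcsin\<close> inverts \<open>sin\<close>.\<close>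

lemma square_base:
  "s \<in> {0..2} \<Longrightarrow> square_a s = 1 - s" "s \<in> {2..4} \<Longrightarrow> square_a s = s - 3"
  "s \<in> {0..1} \<Longrightarrow> square_b s = s" "s \<in> {1..3} \<Longrightarrow> square_b s = 2 - s" "s \<in> {3..4} \<Longrightarrow> square_b s = s - 4"
proof -
  have pi_le: "x \<le> y \<Longrightarrow> pi * x \<le> pi * y" for x y by simp
  have arc: "2 / pi * arcsin (sin (pi * x / 2)) = x" if "x \<in> {-1..1}" for x
    using that pi_le[of x 1] pi_le[of "-1" x] by (subst arcsin_sin) (auto simp: field_simps)
  have "cos (pi * s / 2) = sin (pi * (1 - s) / 2)" "sin (pi * s / 2) = sin (pi * (2 - s) / 2)" for s
    using sin_cos_eq[of "pi * (1 - s) / 2"] sin_pi_minus[of "pi * s / 2"] by (simp_all add: field_simps)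
  moreover have "cos (pi * s / 2) = sin (pi * (s - 3) / 2)" "sin (pi * s / 2) = sin (pi * (s - 4) / 2)" for s
  proof -
    have 1: "sin (pi * (s - 4) / 2) = sin (pi * s / 2 - 2 * pi)" for s by (simp add: field_simps)
    then show "sin (pi * s / 2) = sin (pi * (s - 4) / 2)" by (simp add: sin_diff)
    have "pi * (s - 3) / 2 = pi * s / 2 + pi / 2 - 2 * pi" by (simp add: field_simps)
    then show "cos (pi * s / 2) = sin (pi * (s - 3) / 2)" by (simp only: sin_diff sin_add) simp
  qed
  ultimately show "s \<in> {0..2} \<Longrightarrow> square_a s = 1 - s" "s \<in> {2..4} \<Longrightarrow> square_a s = s - 3"
  "s \<in> {0..1} \<Longrightarrow> square_b s = s" "s \<in> {1..3} \<Longrightarrow> square_b s = 2 - s" "s \<in> {3..4} \<Longrightarrow> square_b s = s - 4"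
    unfolding square_a_def square_b_def
    using arc[of s] arc[of "1 - s"] arc[of "s - 3"] arc[of "2 - s"] arc[of "s - 4"] by auto
qed

lemma square_edge_cases:
  assumes "of_int n \<le> s" "s \<le> of_int n + 1"
  obtains
    "n mod 4 = 0" "square_a s = 1 - (s - of_int n)" "square_b s = s - of_int n"
  | "n mod 4 = 1" "square_a s = - (s - of_int n)" "square_b s = 1 - (s - of_int n)"
  | "n mod 4 = 2" "square_a s = s - of_int n - 1" "square_b s = - (s - of_int n)"
  | "n mod 4 = 3" "square_a s = s - of_int n" "square_b s = s - of_int n - 1"
proof -
  define j where "j = n mod 4"
  have "n = 4 * (n div 4) + j" unfolding j_def by simp
  then have n: "of_int n = 4 * of_int (n div 4) + (of_int j :: real)" by (metis of_int_add of_int_mult of_int_numeral)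
  define x where "x = s - 4 * of_int (n div 4)"
  have x: "square_a s = square_a x" "square_b s = square_b x" unfolding x_def square_periodic by simp_all
  have sn: "s - of_int n = x - of_int j" using n by (simp add: x_def)
  have xj: "of_int j \<le> x" "x \<le> of_int j + 1" using assms n by (auto simp: x_def)
  have "j \<in> {0, 1, 2, 3}" unfolding j_def by auto
  then consider "j = 0" | "j = 1" | "j = 2" | "j = 3" by blast
  then show thesis
  proof cases
    case 1 then show ?thesis using that(1) square_base(1,3)[of x] xj sn x unfolding j_def[symmetric] by simp
  next
    case 2 then show ?thesis using that(2) square_base(1,4)[of x] xj sn x unfolding j_def[symmetric] by simp
  next
    case 3 then show ?thesis using that(3) square_base(2,4)[of x] xj sn x unfolding j_def[symmetric] by simp
  next
    case 4 then show ?thesis using that(4) square_base(2,5)[of x] xj sn x unfolding j_def[symmetric] by simp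
  qed
qed

lemma continuous_on_square:
  fixes S :: "real set"
  assumes "continuous_on S f"
  shows "continuous_on S (\<lambda>t. square_a (f t))" "continuous_on S (\<lambda>t. square_b (f t))"
proof -
  have "continuous_on S (\<lambda>t. pi * f t / 2)" using assms by (intro continuous_intros) auto
  note c = continuous_on_cos[OF this] continuous_on_sin[OF this]
  show "continuous_on S (\<lambda>t. square_a (f t))"
    unfolding square_a_def by (intro continuous_on_mult_left continuous_on_arcsin c) simp
  show "continuous_on S (\<lambda>t. square_b (f t))"
    unfolding square_b_def by (intro continuous_on_mult_left continuous_on_arcsin c) simp
qed

lemma square_abs_sum: "\<bar>square_a s\<bar> + \<bar>square_b s\<bar> = 1"
proof -
  obtain n :: int where n: "of_int n \<le> s" "s \<le> of_int n + 1" by (metis floor_correct less_imp_le of_int_1 of_int_add)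
  then show ?thesis by (cases rule: square_edge_cases) (use n in \<open>auto simp: abs_if\<close>)
qed

lemma square_int: "square_a (of_int n) * square_b (of_int n) = 0"
  by (rule square_edge_cases[of n "of_int n"]) auto

text \<open>The derivatives are the right-hand sides for \<open>h1\<close> and \<open>h2\<close>
  divided by \<open>h3\<close>, which is why the unrolled coordinate moves with speed exactly
  \<open>h3\<close>.\<close>

lemma square_sgn:
  assumes "in_edge n s"
  shows "square_a s * square_b s \<noteq> 0"
    and "sgn (square_a s) * p + sgn (square_b s) * r = edge_force p r n"
    and "(square_a has_real_derivative - sgn (square_b s)) (at s)"
    and "(square_b has_real_derivative sgn (square_a s)) (at s)"
proof -
  have s: "of_int n < s" "s < of_int n + 1" using assms by (auto simp: in_edge_def)
  then have s': "of_int n \<le> s" "s \<le> of_int n + 1" by auto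
  show "square_a s * square_b s \<noteq> 0"
    by (rule square_edge_cases[OF s']) (use s in auto)
  show "sgn (square_a s) * p + sgn (square_b s) * r = edge_force p r n"
    by (rule square_edge_cases[OF s']) (use s in \<open>auto simp: edge_force_def sgn_real_def\<close>)
  have lin: "(f has_real_derivative \<alpha>) (at s)"
    if "\<And>x. x \<in> {of_int n<..<of_int n + 1} \<Longrightarrow> \<beta> + \<alpha> * (x - of_int n) = f x" for f :: "real \<Rightarrow> real" and \<alpha> \<beta>
  proof (rule has_field_derivative_transform_within_open[OF _ _ _ that])
    show "((\<lambda>x. \<beta> + \<alpha> * (x - of_int n)) has_real_derivative \<alpha>) (at s)"
      by (auto intro!: derivative_eq_intros)
    show "open {of_int n<..<of_int n + (1::real)}" by simp
  qed (use s in auto)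
  have form: "n mod 4 = 0 \<longrightarrow> square_a x = 1 - (x - of_int n) \<and> square_b x = x - of_int n"
    "n mod 4 = 1 \<longrightarrow> square_a x = - (x - of_int n) \<and> square_b x = 1 - (x - of_int n)"
    "n mod 4 = 2 \<longrightarrow> square_a x = x - of_int n - 1 \<and> square_b x = - (x - of_int n)"
    "n mod 4 = 3 \<longrightarrow> square_a x = x - of_int n \<and> square_b x = x - of_int n - 1"
    if "x \<in> {of_int n<..<of_int n + 1}" for x
    by (rule square_edge_cases[of n x]; use that in simp)+
  have "(square_a has_real_derivative - sgn (square_b s)) (at s) \<and>
      (square_b has_real_derivative sgn (square_a s)) (at s)"
  proof (rule square_edge_cases[OF s'], goal_cases)
    case 1
    have "(square_a has_real_derivative -1) (at s)" by (rule lin[of 1]) (use form(1) 1(1) in auto)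
    moreover have "(square_b has_real_derivative 1) (at s)" by (rule lin[of 0]) (use form(1) 1(1) in auto)
    ultimately show ?case using 1 s by simp
  next
    case 2
    have "(square_a has_real_derivative -1) (at s)" by (rule lin[of 0]) (use form(2) 2(1) in auto)
    moreover have "(square_b has_real_derivative -1) (at s)" by (rule lin[of 1]) (use form(2) 2(1) in auto)
    ultimately show ?case using 2 s by simp
  next
    case 3
    have "(square_a has_real_derivative 1) (at s)" by (rule lin[of "-1"]) (use form(3) 3(1) in auto)
    moreover have "(square_b has_real_derivative -1) (at s)" by (rule lin[of 0]) (use form(3) 3(1) in auto)
    ultimately show ?case using 3 s by simp
  next
    case 4
    have "(square_a has_real_derivative 1) (at s)" by (rule lin[of 0]) (use form(4) 4(1) in auto)
    moreover have "(square_b has_real_derivative 1) (at s)" by (rule lin[of "-1"]) (use form(4) 4(1) in auto)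
    ultimately show ?case using 4 s by simp
  qed
  then show "(square_a has_real_derivative - sgn (square_b s)) (at s)"
    "(square_b has_real_derivative sgn (square_a s)) (at s)" by auto
qed

lemma square_eq_0_iff: "square_a s * square_b s = 0 \<longleftrightarrow> s \<in> \<int>"
  by (metis Ints_cases in_edge_if_not_Ints square_int square_sgn(1))

text \<open>The table behind the case distinction of the result. For \<open>p > r \<ge> 0\<close>
  the forces on both sides push away from the vertex only for \<open>n mod 4 = 3\<close>, at height
  \<open>p\<close>, and both push back only for \<open>n mod 4 = 1\<close>, at height
  \<open>- p\<close>; the remaining vertices have exactly one exit.\<close>

lemma potential_int_cases:
  obtains "n mod 4 = 0" "potential p r (of_int n) = r" "edge_force p r n = p + r" "edge_force p r (n - 1) = p - r"
  | "n mod 4 = 1" "potential p r (of_int n) = - p" "edge_force p r n = r - p" "edge_force p r (n - 1) = p + r"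
  | "n mod 4 = 2" "potential p r (of_int n) = - r" "edge_force p r n = - (p + r)" "edge_force p r (n - 1) = r - p"
  | "n mod 4 = 3" "potential p r (of_int n) = p" "edge_force p r n = p - r" "edge_force p r (n - 1) = - (p + r)"
proof (rule square_edge_cases[of n "of_int n"], goal_cases)
  case 3 then have "(n - 1) mod 4 = 3" by presburger
  then show ?case using 3 that(1) by (simp add: potential_def edge_force_def)
next
  case 4 then have "(n - 1) mod 4 = 0" by presburger
  then show ?case using 4 that(2) by (simp add: potential_def edge_force_def)
next
  case 5 then have "(n - 1) mod 4 = 1" by presburger
  then show ?case using 5 that(3) by (simp add: potential_def edge_force_def)
next
  case 6 then have "(n - 1) mod 4 = 2" by presburger
  then show ?case using 6 that(4) by (simp add: potential_def edge_force_def)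
qed auto

interpretation square: edge_potential "edge_force p r" "potential p r" for p r
proof
  show "continuous_on UNIV (potential p r)"
    unfolding potential_def by (intro continuous_intros continuous_on_square)
  show "potential p r s = potential p r (of_int n) - edge_force p r n * (s - of_int n)"
    if "of_int n \<le> s" "s \<le> of_int n + 1" for n s
    by (rule potential_int_cases[of n p r]; rule square_edge_cases[OF that];
        simp add: potential_def[of p r s]; simp add: algebra_simps)
  show "finite (range (edge_force p r))"
    by (rule finite_subset[of _ "{p + r, r - p, - (p + r), p - r}"]) (auto simp: edge_force_def)
  have "potential p r (of_int n) \<in> {r, - p, - r, p}" for n
    by (rule potential_int_cases[of n p r]) auto
  then show "finite (range (\<lambda>n::int. potential p r (of_int n)))"
    by (meson finite.emptyI finite.insertI finite_subset image_subsetI)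
qed

section \<open>Continuous angles along curves on the unit circle\<close>

lemma angle_lift:
  fixes u v :: "real \<Rightarrow> real"
  assumes "continuous_on {0..T} u" "continuous_on {0..T} v" "\<And>t. t \<in> {0..T} \<Longrightarrow> (u t)\<^sup>2 + (v t)\<^sup>2 = 1"
  obtains \<phi> where "continuous_on {0..T} \<phi>" "\<And>t. t \<in> {0..T} \<Longrightarrow> u t = cos (\<phi> t)" "\<And>t. t \<in> {0..T} \<Longrightarrow> v t = sin (\<phi> t)"
proof -
  have "continuous_on {0..T} (\<lambda>t. Complex (u t) (v t))"
    using assms by (intro continuous_intros)
  moreover have "Complex (u t) (v t) \<noteq> 0" if "t \<in> {0..T}" for t
    using assms(3)[OF that] by (auto simp: complex_eq_iff)
  \<comment> \<open>The interval is contractible, so the curve has a continuous logarithm; its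
    modulus is 1, so the imaginary part is the angle.\<close>
  ultimately obtain g where g: "continuous_on {0..T} g" "\<And>t. t \<in> {0..T} \<Longrightarrow> Complex (u t) (v t) = exp (g t)"
    using continuous_logarithm_on_contractible[of "{0..T}" "\<lambda>t. Complex (u t) (v t)"]
      convex_imp_contractible[of "{0..T}"] by (metis convex_real_interval(5))
  have *: "u t = cos (Im (g t)) \<and> v t = sin (Im (g t))" if "t \<in> {0..T}" for t
  proof -
    have "cmod (exp (g t)) = 1"
      unfolding g(2)[OF that, symmetric] by (simp add: cmod_def assms(3)[OF that])
    then have "exp (Re (g t)) = 1" by simp
    then show ?thesis using arg_cong[OF g(2)[OF that], of Re] arg_cong[OF g(2)[OF that], of Im]
      by (simp add: Re_exp Im_exp)
  qed
  show thesis
    by (rule that[of "\<lambda>t. Im (g t)"]) (use * g(1) in \<open>auto intro!: continuous_intros\<close>)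
qed

text \<open>Near \<open>t\<close> the angle equals
  \<open>\<phi> t + arcsin (sin (\<phi> s - \<phi> t))\<close>, and the addition formula makes this
  sine differentiable. Taking the difference of angles places the argument of \<open>arcsin\<close>
  at 0, so no case distinction on the quadrant is required.\<close>

lemma angle_derivative:
  fixes \<phi> :: "real \<Rightarrow> real"
  assumes "continuous_on S \<phi>" "t \<in> S"
    and "((\<lambda>s. cos (\<phi> s)) has_real_derivative - sin (\<phi> t) * \<omega>) (at t within S)"
    and "((\<lambda>s. sin (\<phi> s)) has_real_derivative cos (\<phi> t) * \<omega>) (at t within S)"
  shows "(\<phi> has_real_derivative \<omega>) (at t within S)"
proof -
  obtain d where d: "d > 0" "\<And>s. s \<in> S \<Longrightarrow> dist s t < d \<Longrightarrow> dist (\<phi> s) (\<phi> t) < pi / 2"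
    using assms(1,2) unfolding continuous_on_iff by (metis half_gt_zero pi_gt_zero)
  let ?g = "\<lambda>s. sin (\<phi> s) * cos (\<phi> t) - cos (\<phi> s) * sin (\<phi> t)"
  have g: "?g s = sin (\<phi> s - \<phi> t)" for s by (simp add: sin_diff)
  have "(?g has_real_derivative cos (\<phi> t) * \<omega> * cos (\<phi> t) - - sin (\<phi> t) * \<omega> * sin (\<phi> t)) (at t within S)"
    by (intro DERIV_diff DERIV_cmult_right assms)
  moreover have "cos (\<phi> t) * \<omega> * cos (\<phi> t) - - sin (\<phi> t) * \<omega> * sin (\<phi> t) = \<omega> * ((sin (\<phi> t))\<^sup>2 + (cos (\<phi> t))\<^sup>2)"
    by (simp only: power2_eq_square algebra_simps)
  ultimately have dg: "(?g has_real_derivative \<omega>) (at t within S)" by simp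
  have "(arcsin has_real_derivative inverse (sqrt (1 - 0\<^sup>2))) (at (?g t))"
    using DERIV_arcsin[of 0] by simp
  from DERIV_chain2[OF this dg]
  have "((\<lambda>s. arcsin (?g s)) has_real_derivative \<omega>) (at t within S)" by simp
  from DERIV_add[OF DERIV_const[of "\<phi> t"] this]
  have "((\<lambda>s. \<phi> t + arcsin (?g s)) has_real_derivative \<omega>) (at t within S)" by simp
  then show ?thesis
  proof (rule has_field_derivative_transform_within[OF _ d(1) assms(2)])
    show "\<phi> t + arcsin (?g s) = \<phi> s" if "s \<in> S" "dist s t < d" for s
    proof -
      have "- (pi / 2) \<le> \<phi> s - \<phi> t" "\<phi> s - \<phi> t \<le> pi / 2"
        using d(2)[OF that] unfolding dist_real_def by linarith+
      then show ?thesis unfolding g by (simp add: arcsin_sin)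
    qed
  qed
qed

text \<open>Common ground of the angular system and of the extremals, with the level
  \<open>H = 1\<close> built in. Only this system is compared with motions on the unrolled
  square.\<close>

definition vertical :: "real \<Rightarrow> real \<Rightarrow> real \<Rightarrow> (real \<Rightarrow> real) \<Rightarrow> (real \<Rightarrow> real) \<Rightarrow> (real \<Rightarrow> real) \<Rightarrow> bool" where
  "vertical p r T a b c \<longleftrightarrow>
     continuous_on {0..T} a \<and> continuous_on {0..T} b \<and> continuous_on {0..T} c \<and>
     finite {t \<in> {0..T}. a t * b t = 0} \<and> (\<forall>t\<in>{0..T}. \<bar>a t\<bar> + \<bar>b t\<bar> = 1) \<and>
     (\<forall>t\<in>{0..T}. a t * b t \<noteq> 0 \<longrightarrow>
        (a has_real_derivative - sgn (b t) * c t) (at t within {0..T}) \<and>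
        (b has_real_derivative sgn (a t) * c t) (at t within {0..T}) \<and>
        (c has_real_derivative sgn (a t) * p + sgn (b t) * r) (at t within {0..T}))"

lemma verticalD:
  assumes "vertical p r T a b c"
  shows "continuous_on {0..T} a" "continuous_on {0..T} b" "continuous_on {0..T} c"
    "finite {t \<in> {0..T}. a t * b t = 0}"
    "\<And>t. t \<in> {0..T} \<Longrightarrow> \<bar>a t\<bar> + \<bar>b t\<bar> = 1"
    "\<And>t. t \<in> {0..T} \<Longrightarrow> a t * b t \<noteq> 0 \<Longrightarrow> (a has_real_derivative - sgn (b t) * c t) (at t within {0..T})"
    "\<And>t. t \<in> {0..T} \<Longrightarrow> a t * b t \<noteq> 0 \<Longrightarrow> (b has_real_derivative sgn (a t) * c t) (at t within {0..T})"
    "\<And>t. t \<in> {0..T} \<Longrightarrow> a t * b t \<noteq> 0 \<Longrightarrow>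
       (c has_real_derivative sgn (a t) * p + sgn (b t) * r) (at t within {0..T})"
  using assms unfolding vertical_def by blast+

lemma vertical_of_motion:
  assumes f: "edge_motion (edge_force p r) T f"
  shows "vertical p r T (\<lambda>t. square_a (fst (f t))) (\<lambda>t. square_b (fst (f t))) (\<lambda>t. snd (f t))"
  unfolding vertical_def
proof (intro conjI ballI impI)
  show "finite {t \<in> {0..T}. square_a (fst (f t)) * square_b (fst (f t)) = 0}"
    unfolding square_eq_0_iff using f by (simp add: edge_motion_def)
  fix t assume t: "t \<in> {0..T}" and "square_a (fst (f t)) * square_b (fst (f t)) \<noteq> 0"
  then have ni: "fst (f t) \<notin> \<int>" unfolding square_eq_0_iff by blast
  then have "(f has_vector_derivative (snd (f t), edge_force p r \<lfloor>fst (f t)\<rfloor>)) (at t within {0..T})"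
    using f t by (simp add: edge_motion_def)
  note d = has_vector_derivative_fst_snd[OF this]
  note e = square_sgn(2-4)[OF in_edge_if_not_Ints[OF ni]]
  show "((\<lambda>t. square_a (fst (f t))) has_real_derivative - sgn (square_b (fst (f t))) * snd (f t)) (at t within {0..T})"
    by (rule DERIV_chain2[OF e(2) d(1)])
  show "((\<lambda>t. square_b (fst (f t))) has_real_derivative sgn (square_a (fst (f t))) * snd (f t)) (at t within {0..T})"
    by (rule DERIV_chain2[OF e(3) d(1)])
  show "((\<lambda>t. snd (f t)) has_real_derivative sgn (square_a (fst (f t))) * p + sgn (square_b (fst (f t))) * r) (at t within {0..T})"
    unfolding e(1) by (rule d(2))
qed (use edge_motion_continuous[OF f] square_abs_sum in \<open>auto intro: continuous_on_square\<close>)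

lemma square_inverse:
  assumes "\<bar>a\<bar> \<le> 1"
  shows "2 / pi * arcsin (sin (pi * a / 2)) = a"
proof -
  have "\<bar>pi * a\<bar> \<le> pi * 1" unfolding abs_mult using assms by (intro mult_mono) auto
  then show ?thesis by (subst arcsin_sin) (auto simp: abs_le_iff)
qed

lemma sin_square_a: "sin (pi * square_a s / 2) = cos (pi * s / 2)"
  and sin_square_b: "sin (pi * square_b s / 2) = sin (pi * s / 2)"
  by (simp_all add: square_a_def square_b_def)

text \<open>The angles \<open>pi * \<bar>a\<bar> / 2\<close> and
  \<open>pi * \<bar>b\<bar> / 2\<close> are complementary. Hence
  \<open>(sin (pi * a / 2), sin (pi * b / 2))\<close> lies on the unit circle, which maps the square
  to the circle.\<close>

lemma cos_half_pi_mult: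
  assumes "\<bar>a\<bar> + \<bar>b\<bar> = 1"
  shows "cos (pi * a / 2) = sgn b * sin (pi * b / 2)"
proof -
  have "cos (pi * a / 2) = cos (pi * \<bar>a\<bar> / 2)"
    by (cases "a \<ge> 0") auto
  also have "pi * \<bar>a\<bar> / 2 = pi / 2 - pi * \<bar>b\<bar> / 2"
    using assms by (simp add: field_simps flip: distrib_left)
  also have "cos \<dots> = sin (pi * \<bar>b\<bar> / 2)" by (simp add: cos_diff)
  also have "\<dots> = sgn b * sin (pi * b / 2)"
    by (simp add: sgn_real_def abs_if)
  finally show ?thesis .
qed

text \<open>Unrolling a given curve: its image on the circle has a continuous angle \<phi>, and
  \<open>2 / pi * \<phi>\<close> is the coordinate along the unrolled square. The angle also passes
  the vertices continuously, so no branch has to be chosen there.\<close>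

lemma motion_of_vertical:
  assumes v: "vertical p r T a b c" and "T \<ge> 0"
    and init: "square_a s = a 0" "square_b s = b 0"
  obtains f where "f \<in> motions (edge_force p r) (s, c 0) T"
    "\<And>t. t \<in> {0..T} \<Longrightarrow> square_a (fst (f t)) = a t \<and> square_b (fst (f t)) = b t \<and> snd (f t) = c t"
proof -
  note cont = verticalD(1-3)[OF v]
  have ab: "\<bar>a t\<bar> + \<bar>b t\<bar> = 1" "\<bar>b t\<bar> + \<bar>a t\<bar> = 1" if "t \<in> {0..T}" for t
    using verticalD(5)[OF v that] by simp_all
  let ?u = "\<lambda>t. sin (pi * a t / 2)" and ?v = "\<lambda>t. sin (pi * b t / 2)"
  have circle: "(?u t)\<^sup>2 + (?v t)\<^sup>2 = 1" if "t \<in> {0..T}" for t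
  proof -
    have "(sgn (b t) * ?v t)\<^sup>2 = (?v t)\<^sup>2" by (cases "b t = 0") (auto simp: power_mult_distrib sgn_real_def)
    then show ?thesis
      using sin_cos_squared_add[of "pi * a t / 2"] cos_half_pi_mult[OF ab(1)[OF that]] by simp
  qed
  obtain \<phi> where \<phi>: "continuous_on {0..T} \<phi>" "\<And>t. t \<in> {0..T} \<Longrightarrow> ?u t = cos (\<phi> t)" "\<And>t. t \<in> {0..T} \<Longrightarrow> ?v t = sin (\<phi> t)"
    by (rule angle_lift[of T ?u ?v]) (use cont circle in \<open>auto intro!: continuous_intros\<close>)
  have "sin (\<phi> 0) = sin (pi * s / 2) \<and> cos (\<phi> 0) = cos (pi * s / 2)"
    using \<phi>(2,3)[of 0] \<open>T \<ge> 0\<close> sin_square_a[of s] sin_square_b[of s] by (simp add: init)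
  \<comment> \<open>The lift is fixed only up to full turns; this turn number makes it start at the
    prescribed \<open>s\<close>.\<close>
  then obtain m :: int where m: "\<phi> 0 = pi * s / 2 + 2 * pi * m" unfolding sin_cos_eq_iff ..
  define f where "f = restrict (\<lambda>t. (2 / pi * (\<phi> t - 2 * pi * m), c t)) {0..T}"
  have ft: "f t = (2 / pi * (\<phi> t - 2 * pi * m), c t)" if "t \<in> {0..T}" for t using that by (simp add: f_def)
  have ff: "pi * fst (f t) / 2 = \<phi> t - 2 * pi * m" if "t \<in> {0..T}" for t using ft[OF that] by (simp add: field_simps)
  have "cos (\<phi> t - 2 * pi * m) = cos (\<phi> t)" "sin (\<phi> t - 2 * pi * m) = sin (\<phi> t)" for t
    by (simp_all add: cos_diff sin_diff cos_int_2pin sin_int_2pin)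
  then have sq: "square_a (fst (f t)) = a t" "square_b (fst (f t)) = b t" if "t \<in> {0..T}" for t
    using \<phi>(2,3)[OF that] square_inverse[of "a t"] square_inverse[of "b t"] ab[OF that]
    unfolding square_a_def square_b_def ff[OF that] by auto
  have zero: "fst (f t) \<in> \<int> \<longleftrightarrow> a t * b t = 0" if "t \<in> {0..T}" for t
    unfolding square_eq_0_iff[symmetric] sq[OF that] ..
  have "edge_motion (edge_force p r) T f"
    unfolding edge_motion_def
  proof (intro conjI ballI impI)
    have "continuous_on {0..T} (\<lambda>t. (2 / pi * (\<phi> t - 2 * pi * m), c t))"
      by (intro continuous_intros \<phi> cont)
    then show "continuous_on {0..T} f" by (rule continuous_on_eq) (simp add: ft)
    have "{t \<in> {0..T}. fst (f t) \<in> \<int>} = {t \<in> {0..T}. a t * b t = 0}" using zero by blast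
    then show "finite {t \<in> {0..T}. fst (f t) \<in> \<int>}" using verticalD(4)[OF v] by simp
    fix t assume t: "t \<in> {0..T}" and ni: "fst (f t) \<notin> \<int>"
    have nz: "a t * b t \<noteq> 0" using zero[OF t] ni by simp
    note d = verticalD(6-8)[OF v t nz]
    have sg: "sgn (a t) * sgn (a t) = 1" "sgn (b t) * sgn (b t) = 1" using nz by (auto simp: sgn_real_def)
    have half: "((\<lambda>x. sin (pi * x / 2)) has_real_derivative cos (pi * x / 2) * (pi / 2)) (at x)" for x
      by (auto intro!: derivative_eq_intros)
    \<comment> \<open>A quarter turn per edge, hence the factor \<open>pi / 2\<close>.\<close>
    have "(\<phi> has_real_derivative pi / 2 * c t) (at t within {0..T})"
    proof (rule angle_derivative[OF \<phi>(1) t])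
      have "(?u has_real_derivative cos (pi * a t / 2) * (pi / 2) * (- sgn (b t) * c t)) (at t within {0..T})"
        by (rule DERIV_chain2[OF half d(1)])
      also have "cos (pi * a t / 2) * (pi / 2) * (- sgn (b t) * c t)
          = (sgn (b t) * sgn (b t)) * (- ?v t * (pi / 2 * c t))"
        unfolding cos_half_pi_mult[OF ab(1)[OF t]] by (simp only: algebra_simps)
      finally have "(?u has_real_derivative - ?v t * (pi / 2 * c t)) (at t within {0..T})"
        unfolding sg by simp
      then show "((\<lambda>s. cos (\<phi> s)) has_real_derivative - sin (\<phi> t) * (pi / 2 * c t)) (at t within {0..T})"
        unfolding \<phi>(3)[OF t] has_real_derivative_iff_has_vector_derivative
        by (rule has_vector_derivative_transform[OF t, rotated]) (simp add: \<phi>(2))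
      have "(?v has_real_derivative cos (pi * b t / 2) * (pi / 2) * (sgn (a t) * c t)) (at t within {0..T})"
        by (rule DERIV_chain2[OF half d(2)])
      also have "cos (pi * b t / 2) * (pi / 2) * (sgn (a t) * c t)
          = (sgn (a t) * sgn (a t)) * (?u t * (pi / 2 * c t))"
        unfolding cos_half_pi_mult[OF ab(2)[OF t]] by (simp only: algebra_simps)
      finally have "(?v has_real_derivative ?u t * (pi / 2 * c t)) (at t within {0..T})"
        unfolding sg by simp
      then show "((\<lambda>s. sin (\<phi> s)) has_real_derivative cos (\<phi> t) * (pi / 2 * c t)) (at t within {0..T})"
        unfolding \<phi>(2)[OF t] has_real_derivative_iff_has_vector_derivative
        by (rule has_vector_derivative_transform[OF t, rotated]) (simp add: \<phi>(3))
    qed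
    then have "((\<lambda>t. 2 / pi * (\<phi> t - 2 * pi * m)) has_real_derivative 2 / pi * (pi / 2 * c t - 0)) (at t within {0..T})"
      by (intro DERIV_cmult DERIV_diff DERIV_const)
    then have "((\<lambda>t. 2 / pi * (\<phi> t - 2 * pi * m)) has_real_derivative c t) (at t within {0..T})"
      by simp
    with d(3) have "((\<lambda>t. (2 / pi * (\<phi> t - 2 * pi * m), c t)) has_vector_derivative (c t, sgn (a t) * p + sgn (b t) * r)) (at t within {0..T})"
      unfolding has_real_derivative_iff_has_vector_derivative by (intro has_vector_derivative_Pair)
    moreover have "sgn (a t) * p + sgn (b t) * r = edge_force p r \<lfloor>fst (f t)\<rfloor>"
      using square_sgn(2)[OF in_edge_if_not_Ints[OF ni]] unfolding sq[OF t] by simp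
    ultimately have "((\<lambda>t. (2 / pi * (\<phi> t - 2 * pi * m), c t)) has_vector_derivative (snd (f t), edge_force p r \<lfloor>fst (f t)\<rfloor>)) (at t within {0..T})"
      using ft[OF t] by simp
    then show "(f has_vector_derivative (snd (f t), edge_force p r \<lfloor>fst (f t)\<rfloor>)) (at t within {0..T})"
      by (rule has_vector_derivative_transform[OF t, rotated]) (simp add: ft)
  qed
  moreover have "f 0 = (s, c 0)" using ft[of 0] \<open>T \<ge> 0\<close> m by simp
  moreover have "f \<in> extensional {0..T}" by (simp add: f_def)
  ultimately show thesis using sq ft that[of f] by (simp add: motions_def)
qed

section \<open>The system for the angle\<close>

lemma has_real_derivative_transform:
  fixes f g :: "real \<Rightarrow> real"
  assumes "(f has_real_derivative D) (at t within S)" "t \<in> S" "\<And>s. s \<in> S \<Longrightarrow> g s = f s"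
  shows "(g has_real_derivative D) (at t within S)"
  using assms(1) unfolding has_real_derivative_iff_has_vector_derivative
  by (rule has_vector_derivative_transform[OF assms(2,3), rotated])

lemma switching_angle_iff: "switching_angle u \<longleftrightarrow> cos u * sin u = 0"
proof -
  have "cos u * sin u = 0 \<longleftrightarrow> sin (2 * u) = 0"
    by (auto simp: sin_double)
  also have "\<dots> \<longleftrightarrow> switching_angle u"
    unfolding sin_zero_iff_int2 switching_angle_def by (auto simp: field_simps)
  finally show ?thesis ..
qed

text \<open>The function \<open>sgn u * u\<^sup>2\<close> is \<open>u * \<bar>u\<bar>\<close>, with
  derivative \<open>2 * \<bar>u\<bar>\<close>. In the chain rule this and the inner derivative
  produce the modulus of \<open>sin (2 * \<theta>)\<close> up to a sign, which cancels the singular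
  denominator.\<close>

lemma vertical_of_theta:
  assumes "theta_system p r T \<theta> \<eta>"
  shows "vertical p r T (\<lambda>t. sgn (cos (\<theta> t)) * (cos (\<theta> t))\<^sup>2) (\<lambda>t. sgn (sin (\<theta> t)) * (sin (\<theta> t))\<^sup>2) \<eta>"
proof -
  let ?a = "\<lambda>t. cos (\<theta> t) * \<bar>cos (\<theta> t)\<bar>" and ?b = "\<lambda>t. sin (\<theta> t) * \<bar>sin (\<theta> t)\<bar>"
  have sq: "sgn u * u\<^sup>2 = u * \<bar>u\<bar>" for u :: real
    by (simp add: sgn_real_def power2_eq_square)
  have sgnm: "sgn (u * \<bar>u\<bar>) = sgn u" for u :: real
    by (simp add: sgn_real_def mult_less_0_iff zero_less_mult_iff)
  have dabs: "((\<lambda>u. u * \<bar>u\<bar>) has_real_derivative 2 * \<bar>u\<bar>) (at u)" if "u \<noteq> 0" for u :: real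
    by (rule derivative_eq_intros has_real_derivative_abs[OF that] refl)+ (simp add: sgn_real_def abs_if that)
  have quot: "2 * \<bar>v\<bar> * (u * (e / \<bar>2 * u * v\<bar>)) = sgn u * e"
    if "u \<noteq> 0" "v \<noteq> 0" for u v e :: real
    using that by (simp add: abs_mult sgn_real_def)
  have cont: "continuous_on {0..T} \<theta>" "continuous_on {0..T} \<eta>"
    using assms by (auto simp: theta_system_def)
  have nz: "?a t * ?b t = 0 \<longleftrightarrow> switching_angle (\<theta> t)" for t
    by (auto simp: switching_angle_iff)
  have "vertical p r T ?a ?b \<eta>"
    unfolding vertical_def
  proof (intro conjI ballI impI)
    show "finite {t \<in> {0..T}. ?a t * ?b t = 0}"
      unfolding nz using assms by (simp add: theta_system_def)
    have "\<bar>?a t\<bar> + \<bar>?b t\<bar> = (sin (\<theta> t))\<^sup>2 + (cos (\<theta> t))\<^sup>2" for t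
      by (simp add: abs_mult flip: power2_eq_square)
    then show "\<bar>?a t\<bar> + \<bar>?b t\<bar> = 1" for t by simp
    fix t assume t: "t \<in> {0..T}" and "?a t * ?b t \<noteq> 0"
    then have ns: "\<not> switching_angle (\<theta> t)" and nz': "cos (\<theta> t) \<noteq> 0" "sin (\<theta> t) \<noteq> 0"
      using nz[of t] by auto
    have d: "(\<theta> has_real_derivative \<eta> t / \<bar>sin (2 * \<theta> t)\<bar>) (at t within {0..T})"
      and d\<eta>: "(\<eta> has_real_derivative sgn (cos (\<theta> t)) * p + sgn (sin (\<theta> t)) * r) (at t within {0..T})"
      using assms t ns by (auto simp: theta_system_def)
    have "((\<lambda>t. cos (\<theta> t)) has_real_derivative - sin (\<theta> t) * (\<eta> t / \<bar>sin (2 * \<theta> t)\<bar>)) (at t within {0..T})"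
      by (rule derivative_eq_intros d refl)+
    from DERIV_chain2[OF dabs[OF nz'(1)] this]
    show "(?a has_real_derivative - sgn (?b t) * \<eta> t) (at t within {0..T})"
      by (rule DERIV_cong) (use quot[OF nz'(2,1), of "\<eta> t"] in \<open>simp only: sgnm sin_double mult_minus_left mult_minus_right\<close>)
    have "((\<lambda>t. sin (\<theta> t)) has_real_derivative cos (\<theta> t) * (\<eta> t / \<bar>sin (2 * \<theta> t)\<bar>)) (at t within {0..T})"
      by (rule derivative_eq_intros d refl)+
    from DERIV_chain2[OF dabs[OF nz'(2)] this]
    show "(?b has_real_derivative sgn (?a t) * \<eta> t) (at t within {0..T})"
      by (rule DERIV_cong) (use quot[OF nz', of "\<eta> t"] in
          \<open>simp only: sgnm sin_double mult.assoc mult.commute[of "sin _" "cos _"]\<close>)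
    show "(\<eta> has_real_derivative sgn (?a t) * p + sgn (?b t) * r) (at t within {0..T})"
      unfolding sgnm by (rule d\<eta>)
  qed (use cont in \<open>auto intro!: continuous_intros\<close>)
  then show ?thesis unfolding sq .
qed

text \<open>In HOL \<open>sqrt\<close> is odd, so \<open>sqrt (a t)\<close> is the signed root that
  inverts \<open>sgn u * u\<^sup>2\<close>. The two signed roots lie on the unit circle because
  \<open>\<bar>a t\<bar> + \<bar>b t\<bar> = 1\<close>, and \<theta> is their angle.\<close>

lemma theta_of_vertical:
  assumes v: "vertical p r T a b c"
  obtains \<theta> where "theta_system p r T \<theta> c"
    "\<And>t. t \<in> {0..T} \<Longrightarrow> sgn (cos (\<theta> t)) * (cos (\<theta> t))\<^sup>2 = a t \<and> sgn (sin (\<theta> t)) * (sin (\<theta> t))\<^sup>2 = b t"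
proof -
  have sqrt2: "(sqrt x)\<^sup>2 = \<bar>x\<bar>" for x
    using real_sqrt_abs[of "sqrt x"] real_sqrt_power[of x 2] by (metis abs_of_nonneg power2_eq_square real_sqrt_abs2 real_sqrt_mult zero_le_power2)
  have sgns: "sgn (sqrt x) * \<bar>x\<bar> = x" for x by (simp add: sgn_real_def)
  have dsqrt: "(sqrt has_real_derivative 1 / (2 * \<bar>sqrt x\<bar>)) (at x)" if "x \<noteq> 0" for x
    by (rule DERIV_real_sqrt_generic) (use that in \<open>auto simp: field_simps\<close>)
  obtain \<theta> where \<theta>: "continuous_on {0..T} \<theta>" "\<And>t. t \<in> {0..T} \<Longrightarrow> sqrt (a t) = cos (\<theta> t)"
    "\<And>t. t \<in> {0..T} \<Longrightarrow> sqrt (b t) = sin (\<theta> t)"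
    by (rule angle_lift[of T "\<lambda>t. sqrt (a t)" "\<lambda>t. sqrt (b t)"])
      (use verticalD(1,2,5)[OF v] in \<open>auto simp: sqrt2 intro: continuous_intros\<close>)
  have sw: "switching_angle (\<theta> t) \<longleftrightarrow> a t * b t = 0" if "t \<in> {0..T}" for t
    unfolding switching_angle_iff \<theta>(2,3)[OF that, symmetric] by simp
  have "theta_system p r T \<theta> c"
    unfolding theta_system_def
  proof (intro conjI ballI impI)
    have "{t \<in> {0..T}. switching_angle (\<theta> t)} = {t \<in> {0..T}. a t * b t = 0}" using sw by blast
    then show "finite {t \<in> {0..T}. switching_angle (\<theta> t)}" using verticalD(4)[OF v] by simp
    fix t assume t: "t \<in> {0..T}" and "\<not> switching_angle (\<theta> t)"
    then have nz: "a t * b t \<noteq> 0" using sw by blast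
    then have nz': "a t \<noteq> 0" "b t \<noteq> 0" by auto
    note d = verticalD(6-8)[OF v t nz]
    have sgn_eq: "sgn (cos (\<theta> t)) = sgn (a t)" "sgn (sin (\<theta> t)) = sgn (b t)"
      unfolding \<theta>(2,3)[OF t, symmetric] by (simp_all add: sgn_real_def)
    have nz'': "cos (\<theta> t) \<noteq> 0" "sin (\<theta> t) \<noteq> 0"
      unfolding \<theta>(2,3)[OF t, symmetric] using nz' by auto
    show "(c has_real_derivative sgn (cos (\<theta> t)) * p + sgn (sin (\<theta> t)) * r) (at t within {0..T})"
      unfolding sgn_eq by (rule d(3))
    have key: "1 / (2 * \<bar>u\<bar>) * (sgn v * e) = v * (e / \<bar>2 * v * u\<bar>)" "1 / (2 * \<bar>u\<bar>) * (sgn v * e) = v * (e / \<bar>2 * u * v\<bar>)" if "u \<noteq> 0" "v \<noteq> 0" for u v e :: real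
      using that by (simp_all add: abs_mult sgn_real_def)
    show "(\<theta> has_real_derivative c t / \<bar>sin (2 * \<theta> t)\<bar>) (at t within {0..T})"
    proof (rule angle_derivative[OF \<theta>(1) t])
      have "((\<lambda>t. sqrt (a t)) has_real_derivative 1 / (2 * \<bar>cos (\<theta> t)\<bar>) * (- sgn (sin (\<theta> t)) * c t)) (at t within {0..T})"
        using DERIV_chain2[OF dsqrt[OF nz'(1)] d(1)] unfolding \<theta>(2)[OF t] sgn_eq .
      then have "((\<lambda>t. sqrt (a t)) has_real_derivative - sin (\<theta> t) * (c t / \<bar>sin (2 * \<theta> t)\<bar>)) (at t within {0..T})"
        by (rule DERIV_cong) (use key(1)[OF nz'', of "c t"] in \<open>simp only: sin_double mult_minus_left mult_minus_right\<close>)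
      then show "((\<lambda>s. cos (\<theta> s)) has_real_derivative - sin (\<theta> t) * (c t / \<bar>sin (2 * \<theta> t)\<bar>)) (at t within {0..T})"
        by (rule has_real_derivative_transform[OF _ t]) (simp add: \<theta>(2))
      have "((\<lambda>t. sqrt (b t)) has_real_derivative 1 / (2 * \<bar>sin (\<theta> t)\<bar>) * (sgn (cos (\<theta> t)) * c t)) (at t within {0..T})"
        using DERIV_chain2[OF dsqrt[OF nz'(2)] d(2)] unfolding \<theta>(3)[OF t] sgn_eq .
      then have "((\<lambda>t. sqrt (b t)) has_real_derivative cos (\<theta> t) * (c t / \<bar>sin (2 * \<theta> t)\<bar>)) (at t within {0..T})"
        by (rule DERIV_cong) (use key(2)[OF nz''(2,1), of "c t"] in \<open>simp only: sin_double\<close>)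
      then show "((\<lambda>s. sin (\<theta> s)) has_real_derivative cos (\<theta> t) * (c t / \<bar>sin (2 * \<theta> t)\<bar>)) (at t within {0..T})"
        by (rule has_real_derivative_transform[OF _ t]) (simp add: \<theta>(3))
    qed
  qed (use \<theta> verticalD(3)[OF v] in auto)
  moreover have "sgn (cos (\<theta> t)) * (cos (\<theta> t))\<^sup>2 = a t \<and> sgn (sin (\<theta> t)) * (sin (\<theta> t))\<^sup>2 = b t" if "t \<in> {0..T}" for t
    unfolding \<theta>(2,3)[OF that, symmetric] sqrt2 sgns by simp
  ultimately show thesis using that by blast
qed

section \<open>Curves in the fibre: number and extension\<close>

definition vertical_curves :: "real \<Rightarrow> real \<Rightarrow> real5 \<Rightarrow> real \<Rightarrow> (real \<Rightarrow> real5) set" where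
  "vertical_curves p r x T = {k \<in> extensional {0..T}. k 0 = x \<and>
     (\<exists>a b c. vertical p r T a b c \<and> (\<forall>t\<in>{0..T}. k t = (a t, b t, c t, p, r)))}"

lemma theta_solutions_eq:
  "theta_solutions l T = vertical_curves (h4 l) (h5 l) (h_coords l) T"
proof (intro equalityI subsetI)
  fix k assume "k \<in> theta_solutions l T"
  then obtain \<theta> \<eta> where k: "k \<in> extensional {0..T}" "k 0 = h_coords l" and \<theta>: "theta_system (h4 l) (h5 l) T \<theta> \<eta>"
    "\<forall>t\<in>{0..T}. k t = (sgn (cos (\<theta> t)) * (cos (\<theta> t))\<^sup>2, sgn (sin (\<theta> t)) * (sin (\<theta> t))\<^sup>2, \<eta> t, h4 l, h5 l)"
    unfolding theta_solutions_def by auto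
  show "k \<in> vertical_curves (h4 l) (h5 l) (h_coords l) T"
    unfolding vertical_curves_def
    by (rule CollectI, intro conjI exI, rule k, rule k, rule vertical_of_theta[OF \<theta>(1)], rule \<theta>(2))
next
  fix k assume "k \<in> vertical_curves (h4 l) (h5 l) (h_coords l) T"
  then obtain a b c where v: "vertical (h4 l) (h5 l) T a b c"
    and k: "k \<in> extensional {0..T}" "k 0 = h_coords l" "\<forall>t\<in>{0..T}. k t = (a t, b t, c t, h4 l, h5 l)"
    unfolding vertical_curves_def by auto
  obtain \<theta> where \<theta>: "theta_system (h4 l) (h5 l) T \<theta> c"
    "\<And>t. t \<in> {0..T} \<Longrightarrow> sgn (cos (\<theta> t)) * (cos (\<theta> t))\<^sup>2 = a t \<and> sgn (sin (\<theta> t)) * (sin (\<theta> t))\<^sup>2 = b t"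
    using theta_of_vertical[OF v] by metis
  have "\<forall>t\<in>{0..T}. k t = (sgn (cos (\<theta> t)) * (cos (\<theta> t))\<^sup>2, sgn (sin (\<theta> t)) * (sin (\<theta> t))\<^sup>2, c t, h4 l, h5 l)"
    using k(3) \<theta>(2) by simp
  then show "k \<in> theta_solutions l T"
    unfolding theta_solutions_def
    by (intro CollectI conjI exI) (rule k \<theta>(1) | assumption)+
qed

text \<open>Any \<open>s\<close> over the starting point of the square serves. A description as an
  image suffices, since \<open>determined\<close> passes to images.\<close>

lemma vertical_curves_eq:
  assumes "T \<ge> 0" "square_a s = a" "square_b s = b"
  shows "vertical_curves p r (a, b, c, p, r) T =
    (\<lambda>f. restrict (\<lambda>t. (square_a (fst (f t)), square_b (fst (f t)), snd (f t), p, r)) {0..T}) ` motions (edge_force p r) (s, c) T"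
    (is "_ = ?\<Phi> ` _")
proof (intro equalityI subsetI)
  fix k assume "k \<in> vertical_curves p r (a, b, c, p, r) T"
  then obtain a' b' c' where v: "vertical p r T a' b' c'" and k: "k \<in> extensional {0..T}" "k 0 = (a, b, c, p, r)"
    "\<And>t. t \<in> {0..T} \<Longrightarrow> k t = (a' t, b' t, c' t, p, r)"
    unfolding vertical_curves_def by blast
  have "a' 0 = a" "b' 0 = b" "c' 0 = c" using k(2) k(3)[of 0] assms(1) by auto
  then obtain f where f: "f \<in> motions (edge_force p r) (s, c) T"
    "\<And>t. t \<in> {0..T} \<Longrightarrow> square_a (fst (f t)) = a' t \<and> square_b (fst (f t)) = b' t \<and> snd (f t) = c' t"
    using motion_of_vertical[OF v assms(1), of s] assms(2,3) by metis
  have "k = ?\<Phi> f"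
    by (rule extensionalityI[OF k(1) restrict_extensional]) (use f(2) k(3) in auto)
  with f(1) show "k \<in> ?\<Phi> ` motions (edge_force p r) (s, c) T" by blast
next
  fix k assume "k \<in> ?\<Phi> ` motions (edge_force p r) (s, c) T"
  then obtain f where f: "edge_motion (edge_force p r) T f" "f 0 = (s, c)" "k = ?\<Phi> f"
    unfolding motions_def by blast
  show "k \<in> vertical_curves p r (a, b, c, p, r) T"
    unfolding vertical_curves_def using vertical_of_motion[OF f(1)] f(2,3) assms by simp blast
qed

lemma square_surj:
  assumes "\<bar>a\<bar> + \<bar>b\<bar> = 1"
  obtains s where "square_a s = a" "square_b s = b"
proof -
  have "(sgn b * sin (pi * b / 2))\<^sup>2 = (sin (pi * b / 2))\<^sup>2"
    by (cases "b = 0") (auto simp: power_mult_distrib sgn_real_def)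
  then have "(sin (pi * a / 2))\<^sup>2 + (sin (pi * b / 2))\<^sup>2 = 1"
    using sin_cos_squared_add[of "pi * a / 2"] cos_half_pi_mult[OF assms] by simp
  then obtain t where t: "sin (pi * a / 2) = cos t" "sin (pi * b / 2) = sin t"
    by (metis sincos_total_2pi)
  show thesis
  proof (rule that)
    show "square_a (2 * t / pi) = a" "square_b (2 * t / pi) = b"
      using square_inverse[of a] square_inverse[of b] assms t by (auto simp: square_a_def square_b_def)
  qed
qed

lemma square_energy_at: "square.energy_at p r (s, c) = c\<^sup>2 / 2 + square_a s * r - square_b s * p"
  by (simp add: square.energy_at_def potential_def)

text \<open>Vertices without exit are those with \<open>n mod 4 = 1\<close>, for
  \<open>p = r\<close> also those with \<open>n mod 4 = 2\<close>, and all of them for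
  \<open>p = r = 0\<close>; in each case the potential there is \<open>- p\<close>.\<close>

lemma live_vertices:
  assumes "p \<ge> r" "r \<ge> 0" "E \<noteq> - p" "potential p r (of_int n) = E"
  shows "edge_force p r n > 0 \<or> edge_force p r (n - 1) < 0"
  by (rule potential_int_cases[of n p r]) (use assms in auto)

lemma vertical_curves_determined:
  assumes "p \<ge> r" "r \<ge> 0" "\<bar>a\<bar> + \<bar>b\<bar> = 1" "T \<ge> 0"
    and E: "E = c\<^sup>2 / 2 + a * r - b * p" and ex: "\<not> (E = - p \<and> a * b = 0)"
    and u: "u \<Longrightarrow> E \<noteq> p \<or> p = r"
  shows "determined u (vertical_curves p r (a, b, c, p, r) T)"
proof -
  obtain s where s: "square_a s = a" "square_b s = b" using square_surj[OF assms(3)] .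
  have "determined u (motions (edge_force p r) (s, c) T)"
  proof (cases "E = - p")
    case False
    show ?thesis
    proof (rule square.motions_determined[where E = E and p = p and r = r, OF _ _ _ assms(4)])
      show "edge_force p r n > 0 \<or> edge_force p r (n - 1) < 0" if "potential p r (of_int n) = E" for n
        using live_vertices[OF assms(1,2) False that] .
      \<comment> \<open>Two exits force \<open>n mod 4 = 3\<close>, where the potential is
        \<open>p\<close>; for \<open>p = r\<close> the force to the right of such a vertex vanishes
        and one exit remains.\<close>
      show "\<not> (edge_force p r n > 0 \<and> edge_force p r (n - 1) < 0)" if "u" "potential p r (of_int n) = E" for n
        by (rule potential_int_cases[of n p r]) (use assms(1,2) u that in auto)
      show "square.energy_at p r (s, c) = E" unfolding square_energy_at s E ..
    qed
  next
    case True
    \<comment> \<open>On the minimal level the point starts at rest inside an edge. The potential is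
      linear there and attains its minimum at an inner point, so its slope is zero.\<close>
    have "c = 0" using energy_lower_bound[OF assms(3,1,2), of c] E True by simp
    have "s \<notin> \<int>" using ex True s square_eq_0_iff[of s] by auto
    define n where "n = \<lfloor>s\<rfloor>"
    have n: "in_edge n s" using in_edge_if_not_Ints[OF \<open>s \<notin> \<int>\<close>] by (simp add: n_def)
    then have sn: "of_int n < s" "s < of_int n + 1" by (auto simp: in_edge_def)
    have pot: "potential p r x \<ge> - p" for x
      using energy_lower_bound[OF square_abs_sum assms(1,2), of 0] by (simp add: potential_def)
    have "potential p r s = - p" using E True \<open>c = 0\<close> s by (simp add: potential_def)
    then have *: "edge_force p r n * (s - of_int n) = potential p r (of_int n) + p"
      using square.U_edge[of n s p r] sn by simp
    have "potential p r (of_int n + 1) = potential p r (of_int n) - edge_force p r n"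
      using square.U_edge[of n "of_int n + 1" p r] by simp
    then have "edge_force p r n * (1 - (s - of_int n)) \<le> 0" "edge_force p r n * (s - of_int n) \<ge> 0"
      using * pot[of "of_int n"] pot[of "of_int n + 1"] unfolding right_diff_distrib by simp_all
    then have "\<not> edge_force p r n > 0" "\<not> edge_force p r n < 0"
      using sn mult_pos_pos[of "edge_force p r n" "1 - (s - of_int n)"] mult_neg_pos[of "edge_force p r n" "s - of_int n"]
      by linarith+
    then have "edge_force p r n = 0" by simp
    then show ?thesis unfolding \<open>c = 0\<close> by (rule square.motions_at_rest[OF n _ assms(4)])
  qed
  then show ?thesis unfolding vertical_curves_eq[OF assms(4) s] by (rule determined_image)
qed

text \<open>Above the minimal level no vertex is a dead end, so no curve gets stuck before
  \<open>T\<close>.\<close>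

lemma vertical_curves_extend:
  assumes "p \<ge> r" "r \<ge> 0" "\<bar>a\<bar> + \<bar>b\<bar> = 1" "0 \<le> t" "t \<le> T"
    and E: "c\<^sup>2 / 2 + a * r - b * p \<noteq> - p" and k: "k \<in> vertical_curves p r (a, b, c, p, r) t"
  obtains k' where "k' \<in> vertical_curves p r (a, b, c, p, r) T" "restrict k' {0..t} = k"
proof -
  let ?\<Phi> = "\<lambda>T f. restrict (\<lambda>t. (square_a (fst (f t)), square_b (fst (f t)), snd (f t), p, r)) {0..T}"
  obtain s where s: "square_a s = a" "square_b s = b" using square_surj[OF assms(3)] .
  have T: "T \<ge> 0" using assms by simp
  obtain f where f: "f \<in> motions (edge_force p r) (s, c) t" "k = ?\<Phi> t f"
    using k unfolding vertical_curves_eq[OF assms(4) s] by blast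
  obtain g where g: "g \<in> motions (edge_force p r) (s, c) T" "restrict g {0..t} = f"
  proof (rule square.motions_extend[OF _ _ assms(4,5) f(1)])
    show "edge_force p r n > 0 \<or> edge_force p r (n - 1) < 0" if "potential p r (of_int n) = c\<^sup>2 / 2 + a * r - b * p" for n
      using live_vertices[OF assms(1,2) E that] .
    show "square.energy_at p r (s, c) = c\<^sup>2 / 2 + a * r - b * p" unfolding square_energy_at s ..
  qed
  have "?\<Phi> T g \<in> vertical_curves p r (a, b, c, p, r) T"
    unfolding vertical_curves_eq[OF T s] using g(1) by blast
  moreover have "restrict (?\<Phi> T g) {0..t} = k"
    unfolding f(2) using assms(5) by (auto simp: g(2)[symmetric] fun_eq_iff restrict_def)
  ultimately show thesis using that by blast
qed

section \<open>Reconstruction of the extremals\<close>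

text \<open>The sign makes the integrand discontinuous, but it is measurable and dominated by
  \<open>g\<close>, hence integrable. Its integral is differentiable wherever \<open>s\<close> is
  nonzero, as the integrand is continuous there.\<close>

lemma quadrature:
  fixes s g :: "real \<Rightarrow> real"
  assumes s: "continuous_on {0..T} s" and g: "continuous_on {0..T} g"
  obtains G where "continuous_on {0..T} G" "G 0 = 0"
    "\<And>t. t \<in> {0..T} \<Longrightarrow> s t \<noteq> 0 \<Longrightarrow> (G has_real_derivative sgn (s t) * g t) (at t within {0..T})"
proof -
  define f where "f = (\<lambda>t. sgn (s t) * g t)"
  have meas: "(\<lambda>t. indicator {0..T} t *\<^sub>R s t) \<in> borel_measurable borel"
    "(\<lambda>t. indicator {0..T} t *\<^sub>R g t) \<in> borel_measurable borel"
    using borel_measurable_continuous_on_indicator[OF _ s] borel_measurable_continuous_on_indicator[OF _ g] by auto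
  have "(\<lambda>t. indicator {0..T} t *\<^sub>R f t)
      = (\<lambda>t. sgn (indicator {0..T} t *\<^sub>R s t) * (indicator {0..T} t *\<^sub>R g t))"
    by (auto simp: f_def indicator_def fun_eq_iff)
  then have "set_borel_measurable lborel {0..T} f"
    unfolding set_borel_measurable_def using meas by (simp add: measurable_compose[OF _ borel_measurable_sgn])
  then have "set_integrable lborel {0..T} f"
    by (rule set_integrable_bound[OF borel_integrable_atLeastAtMost'[OF g]])
      (auto simp: f_def abs_mult sgn_real_def)
  then have int: "f integrable_on {0..T}" by (rule set_borel_integral_eq_integral(1))
  show thesis
  proof (rule that)
    show "continuous_on {0..T} (\<lambda>t. integral {0..t} f)" by (rule indefinite_integral_continuous_1[OF int])
    fix t assume t: "t \<in> {0..T}" "s t \<noteq> 0"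
    have "continuous (at t within {0..T}) f"
      using s g t unfolding f_def continuous_on_def continuous_within by (auto intro!: tendsto_intros)
    from integral_has_vector_derivative_continuous_at[OF int, of t "{}"] this t
    show "((\<lambda>t. integral {0..t} f) has_real_derivative sgn (s t) * g t) (at t within {0..T})"
      by (simp add: has_real_derivative_iff_has_vector_derivative f_def)
  qed simp
qed

lemma bang_bang_extremal_cong:
  assumes g: "bang_bang_extremal T \<gamma>" and eq: "\<And>t. t \<in> {0..T} \<Longrightarrow> \<gamma>' t = \<gamma> t"
  shows "bang_bang_extremal T \<gamma>'"
  unfolding bang_bang_extremal_def Let_def
proof (intro conjI ballI impI)
  note g' = g[unfolded bang_bang_extremal_def Let_def]
  show "continuous_on {0..T} \<gamma>'"
    by (rule continuous_on_eq[OF g'[THEN conjunct1]]) (simp add: eq)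
  have "{t \<in> {0..T}. h1 (\<gamma>' t) * h2 (\<gamma>' t) = 0} = {t \<in> {0..T}. h1 (\<gamma> t) * h2 (\<gamma> t) = 0}" using eq by auto
  then show "finite {t \<in> {0..T}. h1 (\<gamma>' t) * h2 (\<gamma>' t) = 0}" using g' by simp
  fix t assume t: "t \<in> {0..T}" and nz: "h1 (\<gamma>' t) * h2 (\<gamma>' t) \<noteq> 0"
  note d = g'[THEN conjunct2, THEN conjunct2, THEN bspec, OF t, THEN mp, OF nz[unfolded eq[OF t]]]
  note tr = has_real_derivative_transform[OF _ t]
  show "((\<lambda>s. h1 (\<gamma>' s)) has_real_derivative - sgn (h2 (\<gamma>' t)) * h3 (\<gamma>' t)) (at t within {0..T})"
    unfolding eq[OF t] by (rule tr[OF d[THEN conjunct1]]) (simp add: eq)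
  note d = d[THEN conjunct2]
  show "((\<lambda>s. h2 (\<gamma>' s)) has_real_derivative sgn (h1 (\<gamma>' t)) * h3 (\<gamma>' t)) (at t within {0..T})"
    unfolding eq[OF t] by (rule tr[OF d[THEN conjunct1]]) (simp add: eq)
  note d = d[THEN conjunct2]
  show "((\<lambda>s. h3 (\<gamma>' s)) has_real_derivative sgn (h1 (\<gamma>' t)) * h4 (\<gamma>' t) + sgn (h2 (\<gamma>' t)) * h5 (\<gamma>' t)) (at t within {0..T})"
    unfolding eq[OF t] by (rule tr[OF d[THEN conjunct1]]) (simp add: eq)
  note d = d[THEN conjunct2]
  show "((\<lambda>s. h4 (\<gamma>' s)) has_real_derivative 0) (at t within {0..T})"
    by (rule tr[OF d[THEN conjunct1]]) (simp add: eq)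
  note d = d[THEN conjunct2]
  show "((\<lambda>s. h5 (\<gamma>' s)) has_real_derivative 0) (at t within {0..T})"
    by (rule tr[OF d[THEN conjunct1]]) (simp add: eq)
  show "((\<lambda>s. fst (\<gamma>' s)) has_vector_derivative
      sgn (h1 (\<gamma>' t)) *\<^sub>R X1 (fst (\<gamma>' t)) + sgn (h2 (\<gamma>' t)) *\<^sub>R X2 (fst (\<gamma>' t))) (at t within {0..T})"
    unfolding eq[OF t] by (rule has_vector_derivative_transform[OF t _ d[THEN conjunct2]]) (simp add: eq)
qed

lemma bang_bang_extremal_shorten:
  assumes g: "bang_bang_extremal T \<gamma>" and "S \<le> T"
  shows "bang_bang_extremal S \<gamma>"
  unfolding bang_bang_extremal_def Let_def
proof (intro conjI ballI impI)
  have sub: "{0..S} \<subseteq> {0..T}" using assms(2) by auto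
  note g' = g[unfolded bang_bang_extremal_def Let_def]
  show "continuous_on {0..S} \<gamma>" using g' sub continuous_on_subset by blast
  show "finite {t \<in> {0..S}. h1 (\<gamma> t) * h2 (\<gamma> t) = 0}"
    by (rule finite_subset[OF _ g'[THEN conjunct2, THEN conjunct1]]) (use sub in auto)
  fix t assume "t \<in> {0..S}" and nz: "h1 (\<gamma> t) * h2 (\<gamma> t) \<noteq> 0"
  then have t: "t \<in> {0..T}" using sub by blast
  note d = g'[THEN conjunct2, THEN conjunct2, THEN bspec, OF t, THEN mp, OF nz]
  note tr = has_field_derivative_subset[OF _ sub]
  show "((\<lambda>s. h1 (\<gamma> s)) has_real_derivative - sgn (h2 (\<gamma> t)) * h3 (\<gamma> t)) (at t within {0..S})"
    by (rule tr[OF d[THEN conjunct1]])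
  note d = d[THEN conjunct2]
  show "((\<lambda>s. h2 (\<gamma> s)) has_real_derivative sgn (h1 (\<gamma> t)) * h3 (\<gamma> t)) (at t within {0..S})"
    by (rule tr[OF d[THEN conjunct1]])
  note d = d[THEN conjunct2]
  show "((\<lambda>s. h3 (\<gamma> s)) has_real_derivative sgn (h1 (\<gamma> t)) * h4 (\<gamma> t) + sgn (h2 (\<gamma> t)) * h5 (\<gamma> t)) (at t within {0..S})"
    by (rule tr[OF d[THEN conjunct1]])
  note d = d[THEN conjunct2]
  show "((\<lambda>s. h4 (\<gamma> s)) has_real_derivative 0) (at t within {0..S})"
    by (rule tr[OF d[THEN conjunct1]])
  note d = d[THEN conjunct2]
  show "((\<lambda>s. h5 (\<gamma> s)) has_real_derivative 0) (at t within {0..S})"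
    by (rule tr[OF d[THEN conjunct1]])
  show "((\<lambda>s. fst (\<gamma> s)) has_vector_derivative
      sgn (h1 (\<gamma> t)) *\<^sub>R X1 (fst (\<gamma> t)) + sgn (h2 (\<gamma> t)) *\<^sub>R X2 (fst (\<gamma> t))) (at t within {0..S})"
    by (rule has_vector_derivative_within_subset[OF d[THEN conjunct2] sub])
qed

lemma restrict_extremal:
  assumes "\<gamma> \<in> bang_bang_extremals l T" "0 \<le> t" "t \<le> T"
  shows "restrict \<gamma> {0..t} \<in> bang_bang_extremals l t"
proof -
  have "bang_bang_extremal t (restrict \<gamma> {0..t})"
    by (rule bang_bang_extremal_cong[OF bang_bang_extremal_shorten[OF _ assms(3)]])
      (use assms(1) in \<open>auto simp: bang_bang_extremals_def\<close>)
  then show ?thesis using assms by (auto simp: bang_bang_extremals_def)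
qed

lemma vertical_of_extremal:
  assumes "l \<in> C_level" "T \<ge> 0" "\<gamma> \<in> bang_bang_extremals l T"
  shows "restrict (h_coords \<circ> \<gamma>) {0..T} \<in> vertical_curves (h4 l) (h5 l) (h_coords l) T"
proof -
  have g0: "\<gamma> 0 = l" and g: "bang_bang_extremal T \<gamma>" using assms(3) by (auto simp: bang_bang_extremals_def)
  define K where "K = {t \<in> {0..T}. h1 (\<gamma> t) * h2 (\<gamma> t) = 0}"
  note cont = continuous_on_h[OF g[unfolded bang_bang_extremal_def, THEN conjunct1]]
  have fin: "finite K" using g by (simp add: bang_bang_extremal_def K_def)
  have ode: "((\<lambda>s. h1 (\<gamma> s)) has_real_derivative - sgn (h2 (\<gamma> t)) * h3 (\<gamma> t)) (at t within {0..T})"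
    "((\<lambda>s. h2 (\<gamma> s)) has_real_derivative sgn (h1 (\<gamma> t)) * h3 (\<gamma> t)) (at t within {0..T})"
    "((\<lambda>s. h3 (\<gamma> s)) has_real_derivative sgn (h1 (\<gamma> t)) * h4 (\<gamma> t) + sgn (h2 (\<gamma> t)) * h5 (\<gamma> t))
       (at t within {0..T})"
    "((\<lambda>s. h4 (\<gamma> s)) has_real_derivative 0) (at t within {0..T})"
    "((\<lambda>s. h5 (\<gamma> s)) has_real_derivative 0) (at t within {0..T})"
    if "t \<in> {0..T}" "h1 (\<gamma> t) * h2 (\<gamma> t) \<noteq> 0" for t
    using g that unfolding bang_bang_extremal_def Let_def by blast+
  have h45: "h4 (\<gamma> t) = h4 l" "h5 (\<gamma> t) = h5 l" if t: "t \<in> {0..T}" for t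
  proof -
    have "h4 (\<gamma> t) = h4 (\<gamma> 0)" "h5 (\<gamma> t) = h5 (\<gamma> 0)"
      using const_if_zero_derivative[OF cont(4) fin _ t] const_if_zero_derivative[OF cont(5) fin _ t] ode(4,5)
      unfolding K_def by auto
    then show "h4 (\<gamma> t) = h4 l" "h5 (\<gamma> t) = h5 l" unfolding g0 by auto
  qed
  have H: "\<bar>h1 (\<gamma> t)\<bar> + \<bar>h2 (\<gamma> t)\<bar> = 1" if t: "t \<in> {0..T}" for t
  proof -
    have "\<bar>h1 (\<gamma> t)\<bar> + \<bar>h2 (\<gamma> t)\<bar> = \<bar>h1 (\<gamma> 0)\<bar> + \<bar>h2 (\<gamma> 0)\<bar>"
    proof (rule const_if_zero_derivative[where K = K and T = T])
      fix s assume s: "s \<in> {0..T} - K"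
      then have s': "s \<in> {0..T}" "h1 (\<gamma> s) * h2 (\<gamma> s) \<noteq> 0" and nz: "h1 (\<gamma> s) \<noteq> 0" "h2 (\<gamma> s) \<noteq> 0"
        by (auto simp: K_def)
      from DERIV_add[OF DERIV_chain2[OF has_real_derivative_abs[OF nz(1)] ode(1)[OF s']]
          DERIV_chain2[OF has_real_derivative_abs[OF nz(2)] ode(2)[OF s']]]
      show "((\<lambda>s. \<bar>h1 (\<gamma> s)\<bar> + \<bar>h2 (\<gamma> s)\<bar>) has_real_derivative 0) (at s within {0..T})"
        by (rule DERIV_cong) (simp add: algebra_simps)
    qed (use t fin cont in \<open>auto intro!: continuous_intros\<close>)
    then show ?thesis using assms(1) g0 by (simp add: C_level_def hamiltonian_def)
  qed
  have "vertical (h4 l) (h5 l) T (\<lambda>t. h1 (\<gamma> t)) (\<lambda>t. h2 (\<gamma> t)) (\<lambda>t. h3 (\<gamma> t))"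
    unfolding vertical_def
  proof (intro conjI ballI impI)
    fix t assume t: "t \<in> {0..T}" and nz: "h1 (\<gamma> t) * h2 (\<gamma> t) \<noteq> 0"
    show "((\<lambda>s. h3 (\<gamma> s)) has_real_derivative sgn (h1 (\<gamma> t)) * h4 l + sgn (h2 (\<gamma> t)) * h5 l) (at t within {0..T})"
      using ode(3)[OF t nz] unfolding h45[OF t] .
  qed (use cont fin ode H in \<open>auto simp: K_def\<close>)
  moreover have "\<forall>t\<in>{0..T}. restrict (h_coords \<circ> \<gamma>) {0..T} t = (h1 (\<gamma> t), h2 (\<gamma> t), h3 (\<gamma> t), h4 l, h5 l)"
    using h45 by (simp add: h_coords_def)
  ultimately show ?thesis
    unfolding vertical_curves_def using g0 assms(2) by auto
qed

lemma h_eq: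
  "h1 ((x, y, z, v, w), (k1, k2, k3, k4, k5)) = k1 - y / 2 * k3 - (x\<^sup>2 + y\<^sup>2) / 2 * k5"
  "h2 ((x, y, z, v, w), (k1, k2, k3, k4, k5)) = k2 + x / 2 * k3 + (x\<^sup>2 + y\<^sup>2) / 2 * k4"
  "h3 ((x, y, z, v, w), (k1, k2, k3, k4, k5)) = k3 + x * k4 + y * k5"
  "h4 ((x, y, z, v, w), (k1, k2, k3, k4, k5)) = k4"
  "h5 ((x, y, z, v, w), (k1, k2, k3, k4, k5)) = k5"
  by (simp_all add: h1_def h2_def h3_def h4_def h5_def inner_Pair field_simps)

text \<open>Over a fixed base point \<open>h_eq\<close> is triangular in the components of the
  covector: \<open>h4\<close> and \<open>h5\<close> give the last two, \<open>h3\<close> the third,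
  \<open>h1\<close> and \<open>h2\<close> the others.\<close>

lemma h_coords_inj:
  assumes "fst g = fst g'" "h_coords g = h_coords g'"
  shows "g = g'"
proof -
  obtain x y z v w k1 k2 k3 k4 k5 where g: "g = ((x, y, z, v, w), (k1, k2, k3, k4, k5))" by (metis prod.exhaust)
  obtain x' y' z' v' w' k1' k2' k3' k4' k5' where g': "g' = ((x', y', z', v', w'), (k1', k2', k3', k4', k5'))" by (metis prod.exhaust)
  show ?thesis using assms unfolding g g' h_coords_def h_eq by auto
qed

lemma X_sum_eq:
  "s1 *\<^sub>R X1 q + s2 *\<^sub>R X2 q = (s1, s2, s2 * (fst q / 2) - s1 * (fst (snd q) / 2),
     s2 * (((fst q)\<^sup>2 + (fst (snd q))\<^sup>2) / 2), - (s1 * (((fst q)\<^sup>2 + (fst (snd q))\<^sup>2) / 2)))"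
  by (cases q) (simp add: algebra_simps)

text \<open>The vertical part fixes the signs, so the velocity of \<open>(x, y)\<close> is known in
  advance, and the velocities of the other coordinates involve the position only through
  \<open>x\<close> and \<open>y\<close>. Hence iterated quadrature solves the base equation.\<close>

lemma extremal_of_vertical:
  assumes "l \<in> C_level" "T \<ge> 0" and k: "k \<in> vertical_curves (h4 l) (h5 l) (h_coords l) T"
  obtains \<gamma> where "\<gamma> \<in> bang_bang_extremals l T" "restrict (h_coords \<circ> \<gamma>) {0..T} = k"
proof -
  define p r where "p = h4 l" and "r = h5 l"
  obtain a b c where vert: "vertical p r T a b c" and kt: "\<And>t. t \<in> {0..T} \<Longrightarrow> k t = (a t, b t, c t, p, r)"
    and ext: "k \<in> extensional {0..T}" and k0: "k 0 = h_coords l"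
    using k unfolding vertical_curves_def p_def r_def by auto
  note V = verticalD[OF vert]
  note quad_a = quadrature[OF V(1)] and quad_b = quadrature[OF V(2)]
  obtain x where x: "continuous_on {0..T} x" "x 0 = 0"
    "\<And>t. t \<in> {0..T} \<Longrightarrow> a t \<noteq> 0 \<Longrightarrow> (x has_real_derivative sgn (a t) * 1) (at t within {0..T})"
    using quad_a[of "\<lambda>_. 1"] continuous_on_const by metis
  obtain y where y: "continuous_on {0..T} y" "y 0 = 0"
    "\<And>t. t \<in> {0..T} \<Longrightarrow> b t \<noteq> 0 \<Longrightarrow> (y has_real_derivative sgn (b t) * 1) (at t within {0..T})"
    using quad_b[of "\<lambda>_. 1"] continuous_on_const by metis
  have cx: "continuous_on {0..T} (\<lambda>t. x t / 2)" "continuous_on {0..T} (\<lambda>t. y t / 2)"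
    "continuous_on {0..T} (\<lambda>t. ((x t)\<^sup>2 + (y t)\<^sup>2) / 2)"
    using x(1) y(1) by (auto intro!: continuous_intros)
  \<comment> \<open>The velocity of \<open>z\<close> mixes the signs of \<open>a\<close> and
    \<open>b\<close>, while \<open>quadrature\<close> handles one sign at a time, so
    \<open>z\<close> is built as a difference.\<close>
  obtain z1 where z1: "continuous_on {0..T} z1" "z1 0 = 0"
    "\<And>t. t \<in> {0..T} \<Longrightarrow> b t \<noteq> 0 \<Longrightarrow> (z1 has_real_derivative sgn (b t) * (x t / 2)) (at t within {0..T})"
    using quad_b[OF cx(1)] by metis
  obtain z2 where z2: "continuous_on {0..T} z2" "z2 0 = 0"
    "\<And>t. t \<in> {0..T} \<Longrightarrow> a t \<noteq> 0 \<Longrightarrow> (z2 has_real_derivative sgn (a t) * (y t / 2)) (at t within {0..T})"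
    using quad_a[OF cx(2)] by metis
  obtain v where v: "continuous_on {0..T} v" "v 0 = 0"
    "\<And>t. t \<in> {0..T} \<Longrightarrow> b t \<noteq> 0 \<Longrightarrow> (v has_real_derivative sgn (b t) * (((x t)\<^sup>2 + (y t)\<^sup>2) / 2)) (at t within {0..T})"
    using quad_b[OF cx(3)] by metis
  obtain w where w: "continuous_on {0..T} w" "w 0 = 0"
    "\<And>t. t \<in> {0..T} \<Longrightarrow> a t \<noteq> 0 \<Longrightarrow> (w has_real_derivative sgn (a t) * (((x t)\<^sup>2 + (y t)\<^sup>2) / 2)) (at t within {0..T})"
    using quad_a[OF cx(3)] by metis
  \<comment> \<open>The third component of the covector. Together with the definition of \<gamma> it
    inverts \<open>h_eq\<close> so that the frame coordinates become the given curve.\<close>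
  define m where "m = (\<lambda>t. c t - x t * p - y t * r)"
  define q where "q = (\<lambda>t. (x t, y t, z1 t - z2 t, v t, - w t))"
  define \<gamma> where "\<gamma> = (\<lambda>t. (q t, (a t + y t / 2 * m t + ((x t)\<^sup>2 + (y t)\<^sup>2) / 2 * r,
    b t - x t / 2 * m t - ((x t)\<^sup>2 + (y t)\<^sup>2) / 2 * p, m t, p, r)))"
  have h: "h1 (\<gamma> t) = a t" "h2 (\<gamma> t) = b t" "h3 (\<gamma> t) = c t" "h4 (\<gamma> t) = p" "h5 (\<gamma> t) = r" for t
    unfolding \<gamma>_def q_def h_eq by (simp_all add: m_def)
  have f: "fst (\<gamma> t) = q t" for t by (simp add: \<gamma>_def)
  have "bang_bang_extremal T \<gamma>"
    unfolding bang_bang_extremal_def Let_def h f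
  proof (intro conjI ballI impI)
    have "continuous_on {0..T} m" unfolding m_def using V x y by (intro continuous_intros)
    then show "continuous_on {0..T} \<gamma>"
      unfolding \<gamma>_def q_def using V(1-3) x y z1 z2 v w by (intro continuous_intros) auto
    fix t assume t: "t \<in> {0..T}" and nz: "a t * b t \<noteq> 0"
    then have nz': "a t \<noteq> 0" "b t \<noteq> 0" by auto
    have "(q has_vector_derivative (sgn (a t) * 1, sgn (b t) * 1, sgn (b t) * (x t / 2) - sgn (a t) * (y t / 2),
        sgn (b t) * (((x t)\<^sup>2 + (y t)\<^sup>2) / 2), - (sgn (a t) * (((x t)\<^sup>2 + (y t)\<^sup>2) / 2)))) (at t within {0..T})"
      unfolding q_def
      by (intro has_vector_derivative_Pair has_vector_derivative_diff has_vector_derivative_minus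
          x(3)[OF t nz'(1), unfolded has_real_derivative_iff_has_vector_derivative]
          y(3)[OF t nz'(2), unfolded has_real_derivative_iff_has_vector_derivative]
          z1(3)[OF t nz'(2), unfolded has_real_derivative_iff_has_vector_derivative]
          z2(3)[OF t nz'(1), unfolded has_real_derivative_iff_has_vector_derivative]
          v(3)[OF t nz'(2), unfolded has_real_derivative_iff_has_vector_derivative]
          w(3)[OF t nz'(1), unfolded has_real_derivative_iff_has_vector_derivative])
    then show "(q has_vector_derivative sgn (a t) *\<^sub>R X1 (q t) + sgn (b t) *\<^sub>R X2 (q t)) (at t within {0..T})"
      unfolding X_sum_eq by (simp add: q_def)
  qed (use V in auto)
  then have "bang_bang_extremal T (restrict \<gamma> {0..T})"
    by (rule bang_bang_extremal_cong) simp
  moreover have "\<gamma> 0 = l"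
  proof (rule h_coords_inj)
    show "fst (\<gamma> 0) = fst l"
      using assms(1) x(2) y(2) z1(2) z2(2) v(2) w(2) by (simp add: f q_def C_level_def zero_prod_def)
    show "h_coords (\<gamma> 0) = h_coords l"
      using kt[of 0] k0 assms(2) h by (simp add: h_coords_def)
  qed
  ultimately have "restrict \<gamma> {0..T} \<in> bang_bang_extremals l T"
    using assms(2) by (simp add: bang_bang_extremals_def)
  moreover have "restrict (h_coords \<circ> restrict \<gamma> {0..T}) {0..T} = k"
    by (rule extensionalityI[OF restrict_extensional ext]) (simp add: kt h_coords_def h)
  ultimately show thesis using that by blast
qed

lemma const_if_zero_vector_derivative:
  fixes f :: "real \<Rightarrow> 'a::banach"
  assumes "continuous_on {0..T} f" "finite K"
    and "\<And>t. t \<in> {0..T} - K \<Longrightarrow> (f has_vector_derivative 0) (at t within {0..T})"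
    and "t \<in> {0..T}"
  shows "f t = f 0"
  by (rule has_derivative_zero_unique_strong_interval[OF assms(2,1) refl _ assms(4)])
    (use assms(3) in \<open>simp add: has_vector_derivative_def\<close>)

lemma inj_on_h_coords_extremals:
  "inj_on (\<lambda>\<gamma>. restrict (h_coords \<circ> \<gamma>) {0..T}) (bang_bang_extremals l T)"
proof (rule inj_onI)
  fix \<gamma> \<gamma>' assume g: "\<gamma> \<in> bang_bang_extremals l T" and g': "\<gamma>' \<in> bang_bang_extremals l T"
    and eq: "restrict (h_coords \<circ> \<gamma>) {0..T} = restrict (h_coords \<circ> \<gamma>') {0..T}"
  have heq: "h_coords (\<gamma> t) = h_coords (\<gamma>' t)" if "t \<in> {0..T}" for t
    using fun_cong[OF eq, of t] that by simp
  then have h12: "h1 (\<gamma>' t) = h1 (\<gamma> t)" "h2 (\<gamma>' t) = h2 (\<gamma> t)" if "t \<in> {0..T}" for t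
    using that by (auto simp: h_coords_def)
  have b: "bang_bang_extremal T \<gamma>" "bang_bang_extremal T \<gamma>'" and init: "\<gamma> 0 = \<gamma>' 0"
    and ext: "\<gamma> \<in> extensional {0..T}" "\<gamma>' \<in> extensional {0..T}"
    using g g' by (auto simp: bang_bang_extremals_def)
  define K where "K = {t \<in> {0..T}. h1 (\<gamma> t) * h2 (\<gamma> t) = 0}"
  have fin: "finite K" using b(1) by (simp add: bang_bang_extremal_def K_def)
  have cont: "continuous_on {0..T} (\<lambda>t. fst (\<gamma> t) - fst (\<gamma>' t))"
    using b by (auto simp: bang_bang_extremal_def intro!: continuous_intros)
  have d: "((\<lambda>t. fst (\<gamma> t) - fst (\<gamma>' t)) has_vector_derivative
      (sgn (h1 (\<gamma> t)) *\<^sub>R X1 (fst (\<gamma> t)) + sgn (h2 (\<gamma> t)) *\<^sub>R X2 (fst (\<gamma> t)))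
      - (sgn (h1 (\<gamma> t)) *\<^sub>R X1 (fst (\<gamma>' t)) + sgn (h2 (\<gamma> t)) *\<^sub>R X2 (fst (\<gamma>' t)))) (at t within {0..T})"
    if t: "t \<in> {0..T} - K" for t
  proof (rule has_vector_derivative_diff)
    have t: "t \<in> {0..T}" "h1 (\<gamma> t) * h2 (\<gamma> t) \<noteq> 0" using t by (auto simp: K_def)
    show "((\<lambda>t. fst (\<gamma> t)) has_vector_derivative
      sgn (h1 (\<gamma> t)) *\<^sub>R X1 (fst (\<gamma> t)) + sgn (h2 (\<gamma> t)) *\<^sub>R X2 (fst (\<gamma> t))) (at t within {0..T})"
      using b(1) t unfolding bang_bang_extremal_def Let_def by blast
    have "h1 (\<gamma>' t) * h2 (\<gamma>' t) \<noteq> 0" using t h12 by simp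
    then have "((\<lambda>t. fst (\<gamma>' t)) has_vector_derivative
      sgn (h1 (\<gamma>' t)) *\<^sub>R X1 (fst (\<gamma>' t)) + sgn (h2 (\<gamma>' t)) *\<^sub>R X2 (fst (\<gamma>' t))) (at t within {0..T})"
      using b(2) t(1) unfolding bang_bang_extremal_def Let_def by blast
    then show "((\<lambda>t. fst (\<gamma>' t)) has_vector_derivative
      sgn (h1 (\<gamma> t)) *\<^sub>R X1 (fst (\<gamma>' t)) + sgn (h2 (\<gamma> t)) *\<^sub>R X2 (fst (\<gamma>' t))) (at t within {0..T})"
      unfolding h12[OF t(1)] .
  qed
  \<comment> \<open>The first two components of the velocity do not depend on the position; the others depend
    on it only through \<open>x\<close> and \<open>y\<close>.\<close>
  have xy: "fst (fst (\<gamma> t)) = fst (fst (\<gamma>' t)) \<and> fst (snd (fst (\<gamma> t))) = fst (snd (fst (\<gamma>' t)))"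
    if t: "t \<in> {0..T}" for t
  proof -
    let ?P = "\<lambda>q::real5. (fst q, fst (snd q))"
    have P: "bounded_linear ?P"
      by (intro bounded_linear_Pair bounded_linear_fst bounded_linear_compose[OF bounded_linear_fst bounded_linear_snd])
    have "?P (fst (\<gamma> t) - fst (\<gamma>' t)) = ?P (fst (\<gamma> 0) - fst (\<gamma>' 0))"
    proof (rule const_if_zero_vector_derivative[OF _ fin _ t])
      show "continuous_on {0..T} (\<lambda>t. ?P (fst (\<gamma> t) - fst (\<gamma>' t)))"
        by (rule bounded_linear.continuous_on[OF P cont])
      show "((\<lambda>t. ?P (fst (\<gamma> t) - fst (\<gamma>' t))) has_vector_derivative 0) (at s within {0..T})"
        if "s \<in> {0..T} - K" for s
        using bounded_linear.has_vector_derivative[OF P d[OF that]]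
        unfolding X_sum_eq by (simp add: zero_prod_def)
    qed
    then show ?thesis using init by simp
  qed
  have q: "fst (\<gamma> t) = fst (\<gamma>' t)" if t: "t \<in> {0..T}" for t
  proof -
    have "fst (\<gamma> t) - fst (\<gamma>' t) = fst (\<gamma> 0) - fst (\<gamma>' 0)"
    proof (rule const_if_zero_vector_derivative[OF cont fin _ t])
      show "((\<lambda>t. fst (\<gamma> t) - fst (\<gamma>' t)) has_vector_derivative 0) (at s within {0..T})"
        if s: "s \<in> {0..T} - K" for s
        using d[OF s] xy[of s] s unfolding X_sum_eq by (simp add: zero_prod_def)
    qed
    then show ?thesis using init by simp
  qed
  show "\<gamma> = \<gamma>'"
    by (rule extensionalityI[OF ext]) (use h_coords_inj q heq in blast)
qed

section \<open>Transfer of the count to extremals\<close>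

lemma theta_solutions_eq_image:
  assumes "l \<in> C_level" "T \<ge> 0"
  shows "theta_solutions l T = (\<lambda>\<gamma>. restrict (h_coords \<circ> \<gamma>) {0..T}) ` bang_bang_extremals l T"
  unfolding theta_solutions_eq
  using vertical_of_extremal[OF assms] extremal_of_vertical[OF assms] by blast

lemma determined_inj_image:
  assumes "inj_on f S" "determined u (f ` S)"
  shows "determined u S"
  using assms unfolding determined_def
  by (metis finite_imageD image_empty is_singleton_altdef card_image)

text \<open>Extremals over one start are determined by their vertical part, so finiteness and
  uniqueness can be pulled back along the injection into the fibre.\<close>

lemma determined_extremals:
  assumes "l \<in> C_level" "h4 l \<ge> h5 l" "h5 l \<ge> 0" "T \<ge> 0"
    and "\<not> (energy l = - h4 l \<and> h1 l * h2 l = 0)" "u \<Longrightarrow> energy l \<noteq> h4 l \<or> h4 l = h5 l"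
  shows "determined u (bang_bang_extremals l T)"
proof -
  have "determined u (vertical_curves (h4 l) (h5 l) (h_coords l) T)"
    unfolding h_coords_def
    by (rule vertical_curves_determined[where E = "energy l"])
      (use assms in \<open>auto simp: C_level_def hamiltonian_def energy_def\<close>)
  then show ?thesis
    unfolding theta_solutions_eq[symmetric] theta_solutions_eq_image[OF assms(1,4)]
    using determined_inj_image[OF inj_on_h_coords_extremals] by blast
qed

text \<open>\<open>Exp l t\<close> is defined by curves on \<open>[0, t]\<close>, but is to be read
  off from curves on \<open>[0, T]\<close>. An extremal is extended through its vertical part, and
  injectivity identifies the restricted lift with the original.\<close>

lemma extremals_restrict_eq:
  assumes "l \<in> C_level" "h4 l \<ge> h5 l" "h5 l \<ge> 0" "0 \<le> t" "t \<le> T" "energy l \<noteq> - h4 l"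
  shows "bang_bang_extremals l t = (\<lambda>\<gamma>. restrict \<gamma> {0..t}) ` bang_bang_extremals l T"
proof (intro equalityI subsetI)
  fix \<gamma> assume g: "\<gamma> \<in> bang_bang_extremals l t"
  have T: "T \<ge> 0" using assms by simp
  obtain k where k: "k \<in> vertical_curves (h4 l) (h5 l) (h_coords l) T"
    "restrict k {0..t} = restrict (h_coords \<circ> \<gamma>) {0..t}"
    unfolding h_coords_def[of l]
  proof (rule vertical_curves_extend[OF assms(2,3) _ assms(4,5)])
    show "\<bar>h1 l\<bar> + \<bar>h2 l\<bar> = 1" using assms(1) by (simp add: C_level_def hamiltonian_def)
    show "(h3 l)\<^sup>2 / 2 + h1 l * h5 l - h2 l * h4 l \<noteq> - h4 l" using assms(6) by (simp add: energy_def)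
    show "restrict (h_coords \<circ> \<gamma>) {0..t} \<in> vertical_curves (h4 l) (h5 l) (h1 l, h2 l, h3 l, h4 l, h5 l) t"
      using vertical_of_extremal[OF assms(1,4) g] by (simp add: h_coords_def)
  qed
  obtain \<delta> where \<delta>: "\<delta> \<in> bang_bang_extremals l T" "restrict (h_coords \<circ> \<delta>) {0..T} = k"
    using extremal_of_vertical[OF assms(1) T k(1)] .
  have "restrict (h_coords \<circ> restrict \<delta> {0..t}) {0..t} = restrict (h_coords \<circ> \<gamma>) {0..t}"
    unfolding k(2)[symmetric] \<delta>(2)[symmetric] using assms(5) by (auto simp: restrict_def)
  then have "restrict \<delta> {0..t} = \<gamma>"
    using inj_onD[OF inj_on_h_coords_extremals] g restrict_extremal[OF \<delta>(1) assms(4,5)] by blast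
  then show "\<gamma> \<in> (\<lambda>\<gamma>. restrict \<gamma> {0..t}) ` bang_bang_extremals l T" using \<delta>(1) by blast
qed (use restrict_extremal assms in blast)

theorem proposition4:
  fixes l :: cotangent
  assumes "l \<in> C_level" and "h4 l \<ge> h5 l" and "h5 l \<ge> 0"
  shows "((energy l \<noteq> h4 l \<and> h4 l > h5 l \<or> h4 l = h5 l) \<and>
          \<not> (energy l = - h4 l \<and> h1 l * h2 l = 0) \<longrightarrow>
           (\<forall>t>0. \<exists>\<gamma> k q.
              theta_solutions l t = {k} \<and>
              bang_bang_extremals l t = {\<gamma>} \<and>
              bang_bang_trajectories l t = {q} \<and>
              (\<forall>s\<in>{0..t}. k s = h_coords (\<gamma> s) \<and> q s = fst (\<gamma> s)) \<and>
              Exp l t = {q t})) \<and>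
         (energy l = h4 l \<and> h4 l > h5 l \<longrightarrow>
           (\<forall>T>0.
              finite (theta_solutions l T) \<and> theta_solutions l T \<noteq> {} \<and>
              finite (bang_bang_extremals l T) \<and> bang_bang_extremals l T \<noteq> {} \<and>
              finite (bang_bang_trajectories l T) \<and> bang_bang_trajectories l T \<noteq> {} \<and>
              theta_solutions l T = (\<lambda>\<gamma>. restrict (h_coords \<circ> \<gamma>) {0..T}) ` bang_bang_extremals l T \<and>
              (\<forall>t\<in>{0..T}. Exp l t = (\<lambda>q. q t) ` bang_bang_trajectories l T)))"
proof (intro conjI impI allI)
  fix t :: real
  assume "(energy l \<noteq> h4 l \<and> h4 l > h5 l \<or> h4 l = h5 l) \<and> \<not> (energy l = - h4 l \<and> h1 l * h2 l = 0)" "t > 0"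
  then have "determined True (bang_bang_extremals l t)"
    using assms by (intro determined_extremals) auto
  then obtain \<gamma> where \<gamma>: "bang_bang_extremals l t = {\<gamma>}"
    by (auto simp: determined_def is_singleton_def)
  define k q where "k = restrict (h_coords \<circ> \<gamma>) {0..t}" and "q = restrict (fst \<circ> \<gamma>) {0..t}"
  have "theta_solutions l t = {k}"
    using theta_solutions_eq_image[OF assms(1), of t] \<open>t > 0\<close> by (simp add: \<gamma> k_def)
  moreover have "bang_bang_trajectories l t = {q}"
    by (simp add: bang_bang_trajectories_def \<gamma> q_def)
  moreover have "Exp l t = {q t}"
    by (simp add: Exp_def calculation)
  moreover have "\<forall>s\<in>{0..t}. k s = h_coords (\<gamma> s) \<and> q s = fst (\<gamma> s)"
    by (simp add: k_def q_def)
  ultimately show "\<exists>\<gamma> k q. theta_solutions l t = {k} \<and> bang_bang_extremals l t = {\<gamma>} \<and>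
      bang_bang_trajectories l t = {q} \<and>
      (\<forall>s\<in>{0..t}. k s = h_coords (\<gamma> s) \<and> q s = fst (\<gamma> s)) \<and> Exp l t = {q t}"
    using \<gamma> by blast
next
  fix T :: real
  assume E: "energy l = h4 l \<and> h4 l > h5 l" and "T > 0"
  \<comment> \<open>From \<open>h4 l > h5 l \<ge> 0\<close> the level is positive, hence not
    minimal.\<close>
  then have E': "energy l \<noteq> - h4 l" using assms by auto
  have "determined False (bang_bang_extremals l T)"
    using assms E' \<open>T > 0\<close> by (intro determined_extremals) auto
  then show *: "finite (bang_bang_extremals l T)" "bang_bang_extremals l T \<noteq> {}"
    by (auto simp: determined_def)
  show im: "theta_solutions l T = (\<lambda>\<gamma>. restrict (h_coords \<circ> \<gamma>) {0..T}) ` bang_bang_extremals l T"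
    using theta_solutions_eq_image assms(1) \<open>T > 0\<close> by simp
  show "finite (theta_solutions l T)" "theta_solutions l T \<noteq> {}"
    unfolding im using * by auto
  show "finite (bang_bang_trajectories l T)" "bang_bang_trajectories l T \<noteq> {}"
    unfolding bang_bang_trajectories_def using * by auto
  show "\<forall>t\<in>{0..T}. Exp l t = (\<lambda>q. q t) ` bang_bang_trajectories l T"
  proof
    fix t assume "t \<in> {0..T}"
    then show "Exp l t = (\<lambda>q. q t) ` bang_bang_trajectories l T"
      unfolding Exp_def bang_bang_trajectories_def image_image
      using extremals_restrict_eq[OF assms, of t T] E' by (simp add: image_image)
  qed
qed

end
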